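(* (In $\mathrm{ZF}$.) $\mathrm{4RC_{fin}}$ implies $\mathrm{4C^-_{fin}}$.
   Context: The base theory is $\mathrm{ZF}$ (no Axiom of Choice). For a set $x$ and $n\in\omega$, $[x]^n$ is the set of all $n$-element subsets of $x$ and $[x]^{>n}$ is the set of all finite subsets of $x$ with more than $n$ elements. $\mathrm{nRC_{fin}}$: given any infinite set $x$, there exist an infinite subset $y\subseteq x$ and a function $f\colon[y]^{>n}\to[y]^n$ such that $f(z)\subseteq z$ for all $z\in[y]^{>n}$. $\mathrm{nC^-_{fin}}$: given any infinite family $\mathcal F$ of finite sets of cardinality greater than $n$, there exist an infinite subfamily $\mathcal A\subseteq\mathcal F$ and a function $f\colon\mathcal A\to[\bigcup\mathcal A]^n$ such that $f(A)\subseteq A$ for all $A\in\mathcal A$. *)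

theory Defs
  imports Main
begin

text \<open>
  HOL has a choice operator, so choice principles about HOL sets are of no interest here. Statements
  "in ZF" are therefore interpreted in an arbitrary structure for the language of set theory that
  satisfies the first-order axioms of ZF. Separation and Replacement are schemas over
  syntactic first-order formulas; a single second-order axiom quantifying over HOL predicates would
  exclude the models in which choice fails.
\<close>

datatype fm = Mem nat nat | Eq nat nat | Neg fm | Conj fm fm | All nat fm

locale set_structure =
  fixes mem :: "'a \<Rightarrow> 'a \<Rightarrow> bool"  (infix "\<in>\<^sub>m" 50)
begin

primrec sat :: "(nat \<Rightarrow> 'a) \<Rightarrow> fm \<Rightarrow> bool" where
  "sat s (Mem i j) \<longleftrightarrow> s i \<in>\<^sub>m s j"
| "sat s (Eq i j) \<longleftrightarrow> s i = s j"
| "sat s (Neg p) \<longleftrightarrow> \<not> sat s p"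
| "sat s (Conj p q) \<longleftrightarrow> sat s p \<and> sat s q"
| "sat s (All i p) \<longleftrightarrow> (\<forall>a. sat (s(i := a)) p)"

text \<open>
  All quantifiers in the notions below range over elements of the structure, so they are the
  usual first-order notions relativized to it. HOL sets are used only
  for definable classes of elements.
\<close>

definition ext :: "'a \<Rightarrow> 'a set" where
  "ext x = {u. u \<in>\<^sub>m x}"

definition subset :: "'a \<Rightarrow> 'a \<Rightarrow> bool"  (infix "\<subseteq>\<^sub>m" 50) where
  "x \<subseteq>\<^sub>m y \<longleftrightarrow> (\<forall>u. u \<in>\<^sub>m x \<longrightarrow> u \<in>\<^sub>m y)"

text \<open>The sets introduced by definite descriptions exist uniquely in every model of ZF; see below.\<close>

definition zero :: 'a where
  "zero = (THE z. \<forall>u. \<not> u \<in>\<^sub>m z)"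

definition succ :: "'a \<Rightarrow> 'a" where
  "succ x = (THE y. \<forall>u. u \<in>\<^sub>m y \<longleftrightarrow> u \<in>\<^sub>m x \<or> u = x)"

definition union :: "'a \<Rightarrow> 'a" where
  "union x = (THE y. \<forall>u. u \<in>\<^sub>m y \<longleftrightarrow> (\<exists>v. v \<in>\<^sub>m x \<and> u \<in>\<^sub>m v))"

definition upair :: "'a \<Rightarrow> 'a \<Rightarrow> 'a" where
  "upair a b = (THE p. \<forall>u. u \<in>\<^sub>m p \<longleftrightarrow> u = a \<or> u = b)"

definition opair :: "'a \<Rightarrow> 'a \<Rightarrow> 'a" where
  "opair a b = upair (upair a a) (upair a b)"

definition is_inductive :: "'a \<Rightarrow> bool" where
  "is_inductive I \<longleftrightarrow> zero \<in>\<^sub>m I \<and> (\<forall>a. a \<in>\<^sub>m I \<longrightarrow> succ a \<in>\<^sub>m I)"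

text \<open>The natural numbers of the structure; they may include nonstandard elements.\<close>

definition omega :: "'a set" where
  "omega = {m. \<forall>I. is_inductive I \<longrightarrow> m \<in>\<^sub>m I}"

primrec vN :: "nat \<Rightarrow> 'a" where
  "vN 0 = zero"
| "vN (Suc k) = succ (vN k)"

text \<open>\<open>f\<close> is an element of the structure that is a function (a set of Kuratowski pairs)
  from the class \<open>X\<close> to the class \<open>Y\<close>.\<close>

definition is_fun :: "'a \<Rightarrow> 'a set \<Rightarrow> 'a set \<Rightarrow> bool" where
  "is_fun f X Y \<longleftrightarrow>
     (\<forall>p. p \<in>\<^sub>m f \<longrightarrow> (\<exists>a\<in>X. \<exists>b\<in>Y. p = opair a b)) \<and>
     (\<forall>a\<in>X. \<exists>!b. opair a b \<in>\<^sub>m f)"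

definition app :: "'a \<Rightarrow> 'a \<Rightarrow> 'a" where
  "app f a = (THE b. opair a b \<in>\<^sub>m f)"

definition equipollent :: "'a \<Rightarrow> 'a \<Rightarrow> bool"  (infix "\<approx>\<^sub>m" 50) where
  "x \<approx>\<^sub>m y \<longleftrightarrow> (\<exists>f. is_fun f (ext x) (ext y) \<and> bij_betw (app f) (ext x) (ext y))"

definition is_finite :: "'a \<Rightarrow> bool" where
  "is_finite x \<longleftrightarrow> (\<exists>m\<in>omega. x \<approx>\<^sub>m m)"

text \<open>\<open>x\<close> is finite and its cardinality \<open>m\<close> is greater than \<open>n\<close>, that is, \<open>n\<close> is an element of
  \<open>m\<close>.\<close>

definition finite_card_gt :: "'a \<Rightarrow> 'a \<Rightarrow> bool" where
  "finite_card_gt n x \<longleftrightarrow> (\<exists>m\<in>omega. n \<in>\<^sub>m m \<and> x \<approx>\<^sub>m m)"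

text \<open>\<open>[x]\<^sup>n\<close> and \<open>[x]\<^sup>>\<^sup>n\<close>, for \<open>n\<close> in \<open>omega\<close>\<close>

definition subsets_card :: "'a \<Rightarrow> 'a \<Rightarrow> 'a set" where
  "subsets_card x n = {z. z \<subseteq>\<^sub>m x \<and> z \<approx>\<^sub>m n}"

definition subsets_gt :: "'a \<Rightarrow> 'a \<Rightarrow> 'a set" where
  "subsets_gt x n = {z. z \<subseteq>\<^sub>m x \<and> finite_card_gt n z}"

definition RC_fin :: "'a \<Rightarrow> bool" where
  "RC_fin n \<longleftrightarrow>
     (\<forall>x. \<not> is_finite x \<longrightarrow>
       (\<exists>y f. y \<subseteq>\<^sub>m x \<and> \<not> is_finite y \<and>
          is_fun f (subsets_gt y n) (subsets_card y n) \<and>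
          (\<forall>z\<in>subsets_gt y n. app f z \<subseteq>\<^sub>m z)))"

definition C_fin_minus :: "'a \<Rightarrow> bool" where
  "C_fin_minus n \<longleftrightarrow>
     (\<forall>F. \<not> is_finite F \<and> (\<forall>A. A \<in>\<^sub>m F \<longrightarrow> finite_card_gt n A) \<longrightarrow>
       (\<exists>G f. G \<subseteq>\<^sub>m F \<and> \<not> is_finite G \<and>
          is_fun f (ext G) (subsets_card (union G) n) \<and>
          (\<forall>A\<in>ext G. app f A \<subseteq>\<^sub>m A)))"

end

locale ZF = set_structure +
  assumes extensionality: "(\<forall>u. u \<in>\<^sub>m x \<longleftrightarrow> u \<in>\<^sub>m y) \<Longrightarrow> x = y"
    and foundation: "\<exists>u. u \<in>\<^sub>m x \<Longrightarrow> \<exists>u. u \<in>\<^sub>m x \<and> \<not> (\<exists>v. v \<in>\<^sub>m u \<and> v \<in>\<^sub>m x)"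
    and pairing: "\<exists>p. \<forall>u. u \<in>\<^sub>m p \<longleftrightarrow> u = a \<or> u = b"
    and union_ax: "\<exists>y. \<forall>u. u \<in>\<^sub>m y \<longleftrightarrow> (\<exists>v. v \<in>\<^sub>m x \<and> u \<in>\<^sub>m v)"
    and power_set: "\<exists>y. \<forall>u. u \<in>\<^sub>m y \<longleftrightarrow> u \<subseteq>\<^sub>m x"
    and infinity: "\<exists>I. (\<exists>e. e \<in>\<^sub>m I \<and> (\<forall>u. \<not> u \<in>\<^sub>m e)) \<and>
        (\<forall>a. a \<in>\<^sub>m I \<longrightarrow> (\<exists>b. b \<in>\<^sub>m I \<and> (\<forall>u. u \<in>\<^sub>m b \<longleftrightarrow> u \<in>\<^sub>m a \<or> u = a)))"
    \<comment> \<open>The assignment \<open>s\<close> supplies the parameters of the formula.\<close>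
    and separation: "\<exists>y. \<forall>u. u \<in>\<^sub>m y \<longleftrightarrow> u \<in>\<^sub>m x \<and> sat (s(i := u)) \<phi>"
    and replacement: "\<lbrakk>i \<noteq> j;
        \<forall>u v w. u \<in>\<^sub>m x \<and> sat (s(i := u, j := v)) \<phi> \<and> sat (s(i := u, j := w)) \<phi> \<longrightarrow> v = w\<rbrakk> \<Longrightarrow>
        \<exists>y. \<forall>v. v \<in>\<^sub>m y \<longleftrightarrow> (\<exists>u. u \<in>\<^sub>m x \<and> sat (s(i := u, j := v)) \<phi>)"
begin

lemma the_ext:
  assumes "\<exists>y. \<forall>u. u \<in>\<^sub>m y \<longleftrightarrow> P u"
  shows "u \<in>\<^sub>m (THE y. \<forall>u. u \<in>\<^sub>m y \<longleftrightarrow> P u) \<longleftrightarrow> P u"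
proof -
  obtain y where y: "\<forall>u. u \<in>\<^sub>m y \<longleftrightarrow> P u"
    using assms by blast
  have "(THE y. \<forall>u. u \<in>\<^sub>m y \<longleftrightarrow> P u) = y"
    by (rule the_equality) (use y in \<open>auto intro: extensionality\<close>)
  then show ?thesis using y by simp
qed

lemma mem_zero: "\<not> u \<in>\<^sub>m zero"
proof -
  have "\<exists>z. \<forall>u. u \<in>\<^sub>m z \<longleftrightarrow> False"
    using separation[of _ "\<lambda>_. undefined" 0 "Neg (Eq 0 0)"] by simp
  from the_ext[OF this] show ?thesis by (simp add: zero_def)
qed

lemma mem_upair: "u \<in>\<^sub>m upair a b \<longleftrightarrow> u = a \<or> u = b"
  unfolding upair_def by (rule the_ext) (rule pairing)

lemma mem_union: "u \<in>\<^sub>m union x \<longleftrightarrow> (\<exists>v. v \<in>\<^sub>m x \<and> u \<in>\<^sub>m v)"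
  unfolding union_def by (rule the_ext) (rule union_ax)

lemma mem_succ: "u \<in>\<^sub>m succ x \<longleftrightarrow> u \<in>\<^sub>m x \<or> u = x"
  unfolding succ_def
proof (rule the_ext, intro exI allI)
  fix u
  show "u \<in>\<^sub>m union (upair x (upair x x)) \<longleftrightarrow> u \<in>\<^sub>m x \<or> u = x"
    by (auto simp: mem_union mem_upair)
qed

lemma opair_eq_iff: "opair a b = opair c d \<longleftrightarrow> a = c \<and> b = d"
proof
  assume "opair a b = opair c d"
  then have "upair a a = upair c c \<or> upair a a = upair c d"
    and "upair a b = upair c c \<or> upair a b = upair c d"
    and "upair c d = upair a a \<or> upair c d = upair a b"
    unfolding opair_def by (metis mem_upair)+
  then show "a = c \<and> b = d" by (metis mem_upair)
qed simp

lemma app_eq: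
  assumes "is_fun f X Y" and "a \<in> X"
  shows "app f a = b \<longleftrightarrow> opair a b \<in>\<^sub>m f"
proof -
  have "\<exists>!b. opair a b \<in>\<^sub>m f"
    using assms unfolding is_fun_def by blast
  then show ?thesis unfolding app_def by (metis theI')
qed

end

end

theory Submission
  imports Defs
begin

text \<open>
  Apply Ramsey choice to the disjoint union of the family: on infinitely many members it leaves a
  subset of one fixed size, and this size can be taken to be 1, 2 or 4. Indeed, from five or more
  elements the choice function selects four. As for size 3, four points in a union of disjoint
  3-element sets cannot be a union of some of these sets; so every finite set of at least two indices
  determines the nonempty set of those indices whose 3-element set the choice function splits. For
  two-element index sets this is a tournament: either some index has infinitely many predecessors,
  or the in-degrees preorder the indices with finite initial segments. In both cases infinitely many
  indices can be assigned a finite index set for which their 3-element set is split, into parts of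
  sizes 1 and 2. Finally, disjoint selections of equal size are united: 1 + 1 = 2 and 2 + 2 = 4.
\<close>

text \<open>Without choice, no single index can be picked from the set of indices that a given index
  set determines. The selection therefore runs the other way: each index needs its own index set,
  given by a definable rule, whose choice splits the fibre of that index. In-degrees supply such a
  rule, because minima exist in a definable total preorder with finite initial segments. Size 3 is
  the obstacle because it is the only size from 1 to 4 that does not divide 4: selections of size 1
  or 2 can be doubled up to 4 exactly. Formally, Separation and induction are available for
  definable predicates only, and the natural numbers of the structure may be nonstandard. A set that
  is finite in the structure may have infinitely many members when seen from HOL. Hence
  \<open>fin\<close> expresses finiteness internally, while exact sizes appear only as
  \<open>has_card n\<close> for a standard \<open>n\<close>.\<close>

no_notation map_le (infix \<open>\<subseteq>\<^sub>m\<close> 50)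

section \<open>Definability with parameters, closed under logical operations and
  substitution\<close>

primrec ren :: "(nat \<Rightarrow> nat) \<Rightarrow> fm \<Rightarrow> fm" where
  "ren h (Mem i j) = Mem (h i) (h j)"
| "ren h (Eq i j) = Eq (h i) (h j)"
| "ren h (Neg p) = Neg (ren h p)"
| "ren h (Conj p q) = Conj (ren h p) (ren h q)"
| "ren h (All i p) = All (h i) (ren h p)"

fun operand :: "nat + 'a \<Rightarrow> (nat \<Rightarrow> 'a) \<Rightarrow> 'a" where
  "operand (Inl i) e = e i"
| "operand (Inr c) e = c"

context set_structure
begin

text \<open>Bound variables are renamed along with the free ones; injectivity of \<open>h\<close>
  prevents capture.\<close>

lemma sat_ren:
  assumes "inj h"
  shows "sat s (ren h p) \<longleftrightarrow> sat (s \<circ> h) p"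
proof (induction p arbitrary: s)
  case (All i p)
  have "s(h i := a) \<circ> h = (s \<circ> h)(i := a)" for a
    using assms by (auto simp: fun_eq_iff inj_eq)
  then show ?case by (simp only: ren.simps sat.simps All.IH)
qed (simp_all)

text \<open>Definable predicates of an environment, with elements of the structure as parameters.
  Bound variables are de Bruijn indices, so that closure under renaming and substitution needs no
  freshness conditions.\<close>

inductive definable :: "((nat \<Rightarrow> 'a) \<Rightarrow> bool) \<Rightarrow> bool" where
  mem: "definable (\<lambda>e. operand s e \<in>\<^sub>m operand t e)"
| eq: "definable (\<lambda>e. operand s e = operand t e)"
| neg: "definable P \<Longrightarrow> definable (\<lambda>e. \<not> P e)"
| conj: "definable P \<Longrightarrow> definable Q \<Longrightarrow> definable (\<lambda>e. P e \<and> Q e)"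
| all: "definable P \<Longrightarrow> definable (\<lambda>e. \<forall>x. P (case_nat x e))"

text \<open>A term counts as definable if its graph is: position 0 holds the value, and the
  arguments are shifted past it.\<close>

definition definable_term :: "((nat \<Rightarrow> 'a) \<Rightarrow> 'a) \<Rightarrow> bool" where
  "definable_term t \<longleftrightarrow> definable (\<lambda>e. e 0 = t (\<lambda>i. e (Suc i)))"

text \<open>In a formula, even variables stand for the environment and odd ones for parameters.\<close>

definition mix :: "(nat \<Rightarrow> 'a) \<Rightarrow> (nat \<Rightarrow> 'a) \<Rightarrow> nat \<Rightarrow> 'a" where
  "mix e s i = (if even i then e (i div 2) else s (i div 2))"

text \<open>A conjunction needs one parameter assignment for two formulas. The parameters are
  interleaved, while the environment variables that both formulas share stay fixed.\<close>

lemma sat_combine: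
  obtains h1 h2 s where "inj h1" "inj h2" "\<And>e. mix e s \<circ> h1 = mix e s1" "\<And>e. mix e s \<circ> h2 = mix e s2"
proof
  \<comment> \<open>Variable \<open>2k + 1\<close> holds parameter \<open>k\<close>. It moves to
    \<open>4k + c\<close>, that is, to parameter \<open>2k\<close> for \<open>c = 1\<close> and to
    parameter \<open>2k + 1\<close> for \<open>c = 3\<close>.\<close>
  define h where "h c i = (if even i then i else 4 * (i div 2) + c)" for c i :: nat
  have *: "inj (h c)" if "odd c" "c < 4" for c
    unfolding inj_def h_def using that by (auto split: if_splits) presburger+
  show "inj (h 1)" "inj (h 3)" by (auto intro: *)
  define s where "s i = (if even i then s1 (i div 2) else s2 (i div 2))" for i
  have "mix e s (h 1 i) = mix e s1 i" "mix e s (h 3 i) = mix e s2 i" for e i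
  proof -
    consider "even i" | k where "i = 2 * k + 1" by (blast elim: oddE)
    then have "mix e s (h 1 i) = mix e s1 i \<and> mix e s (h 3 i) = mix e s2 i"
    proof cases
      case 2
      have "h 1 i = Suc (2 * (2 * k))" "h 3 i = Suc (2 * Suc (2 * k))" "i = Suc (2 * k)"
        by (simp_all add: 2 h_def)
      then show ?thesis by (simp only: mix_def s_def) simp
    qed (simp add: mix_def h_def)
    then show "mix e s (h 1 i) = mix e s1 i" "mix e s (h 3 i) = mix e s2 i" by simp_all
  qed
  then show "mix e s \<circ> h 1 = mix e s1" "mix e s \<circ> h 3 = mix e s2" for e
    by (simp_all add: fun_eq_iff)
qed

lemma definable_sat: "definable P \<Longrightarrow> \<exists>p s. \<forall>e. P e \<longleftrightarrow> sat (mix e s) p"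
proof (induction rule: definable.induct)
  case (mem s t)
  \<comment> \<open>A constant operand number \<open>k\<close> occupies parameter slot
    \<open>k\<close>, so two constants never compete for one slot.\<close>
  define v where "v u k = (case u of Inl i \<Rightarrow> 2 * i | Inr c \<Rightarrow> 2 * k + 1)" for u :: "nat + 'a" and k :: nat
  define c where "c k = (case (if k = 0 then s else t) of Inl i \<Rightarrow> undefined | Inr c \<Rightarrow> c)" for k :: nat
  have "mix e c (v s 0) = operand s e" "mix e c (v t 1) = operand t e" for e
    by (auto simp: mix_def v_def c_def split: sum.splits)
  then have "\<forall>e. operand s e \<in>\<^sub>m operand t e \<longleftrightarrow> sat (mix e c) (Mem (v s 0) (v t 1))" by simp
  then show ?case by blast
next
  case (eq s t)
  define v where "v u k = (case u of Inl i \<Rightarrow> 2 * i | Inr c \<Rightarrow> 2 * k + 1)" for u :: "nat + 'a" and k :: nat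
  define c where "c k = (case (if k = 0 then s else t) of Inl i \<Rightarrow> undefined | Inr c \<Rightarrow> c)" for k :: nat
  have "mix e c (v s 0) = operand s e" "mix e c (v t 1) = operand t e" for e
    by (auto simp: mix_def v_def c_def split: sum.splits)
  then have "\<forall>e. operand s e = operand t e \<longleftrightarrow> sat (mix e c) (Eq (v s 0) (v t 1))" by simp
  then show ?case by blast
next
  case (neg P)
  then obtain p s where "\<forall>e. P e \<longleftrightarrow> sat (mix e s) p" by blast
  then have "\<forall>e. \<not> P e \<longleftrightarrow> sat (mix e s) (Neg p)" by simp
  then show ?case by blast
next
  case (conj P Q)
  then obtain p s1 q s2 where p: "\<And>e. P e \<longleftrightarrow> sat (mix e s1) p" and q: "\<And>e. Q e \<longleftrightarrow> sat (mix e s2) q" by blast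
  obtain h1 h2 s where h: "inj h1" "inj h2" "\<And>e. mix e s \<circ> h1 = mix e s1" "\<And>e. mix e s \<circ> h2 = mix e s2"
    by (rule sat_combine) blast
  then have "\<forall>e. P e \<and> Q e \<longleftrightarrow> sat (mix e s) (Conj (ren h1 p) (ren h2 q))"
    by (simp add: p q sat_ren)
  then show ?case by blast
next
  case (all P)
  then obtain p s where p: "\<And>e. P e \<longleftrightarrow> sat (mix e s) p" by blast
  \<comment> \<open>The bound variable moves from 0 to 1, the other environment variables move down
    one place and the parameters move up one place. Slot 1 is thereby free for the quantifier, and
    \<open>s'\<close> has a dummy there.\<close>
  define h where "h i = (if i = 0 then 1 else if even i then i - 2 else i + 2)" for i :: nat
  have "inj h" unfolding inj_def h_def by (auto split: if_splits) presburger+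
  define s' where "s' = case_nat undefined s"
  have "(mix e s')(1 := a) \<circ> h = mix (case_nat a e) s" for e a
  proof
    fix i
    show "((mix e s')(1 := a) \<circ> h) i = mix (case_nat a e) s i"
    proof (cases "even i")
      case True
      then obtain k where "i = 2 * k" by blast
      then show ?thesis by (cases k) (auto simp: mix_def h_def)
    next
      case False
      then obtain k where "i = 2 * k + 1" by (rule oddE)
      then show ?thesis by (auto simp: mix_def h_def s'_def)
    qed
  qed
  then have "\<forall>e. (\<forall>x. P (case_nat x e)) \<longleftrightarrow> sat (mix e s') (All 1 (ren h p))"
    by (simp add: p sat_ren[OF \<open>inj h\<close>])
  then show ?case by blast
qed

lemma definable_rename: "definable P \<Longrightarrow> definable (\<lambda>e. P (\<lambda>i. e (h i)))"
proof (induction arbitrary: h rule: definable.induct)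
  case (mem s t)
  have "operand u (\<lambda>i. e (h i)) = operand (map_sum h id u) e" for u :: "nat + 'a" and e
    by (cases u) auto
  then show ?case using definable.mem[of "map_sum h id s" "map_sum h id t"] by simp
next
  case (eq s t)
  have "operand u (\<lambda>i. e (h i)) = operand (map_sum h id u) e" for u :: "nat + 'a" and e
    by (cases u) auto
  then show ?case using definable.eq[of "map_sum h id s" "map_sum h id t"] by simp
next
  case (all P)
  have "case_nat x (\<lambda>i. e (h i)) = (\<lambda>i. case_nat x e (case i of 0 \<Rightarrow> 0 | Suc j \<Rightarrow> Suc (h j)))" for x :: 'a and e
    by (auto simp: fun_eq_iff split: nat.split)
  then show ?case using definable.all[OF all.IH[of "\<lambda>i. case i of 0 \<Rightarrow> 0 | Suc j \<Rightarrow> Suc (h j)"]] by simp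
qed (auto intro: definable.intros)

text \<open>Environment and bound value are separate arguments of \<open>Q\<close>, so that the rule
  applies backwards to an arbitrary quantified body.\<close>

lemma definable_all: "definable (\<lambda>e. Q (\<lambda>i. e (Suc i)) (e 0)) \<Longrightarrow> definable (\<lambda>e. \<forall>x. Q e x)"
  by (drule definable.all) simp

lemma definable_ex:
  assumes "definable (\<lambda>e. Q (\<lambda>i. e (Suc i)) (e 0))"
  shows "definable (\<lambda>e. \<exists>x. Q e x)"
proof -
  have "definable (\<lambda>e. \<not> (\<forall>x. \<not> Q e x))"
    by (rule definable.neg, rule definable_all, rule definable.neg, rule assms)
  then show ?thesis by simp
qed

lemma definable_disj:
  assumes "definable P" "definable Q"
  shows "definable (\<lambda>e. P e \<or> Q e)"
proof -
  have "definable (\<lambda>e. \<not> (\<not> P e \<and> \<not> Q e))"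
    by (rule definable.neg, rule definable.conj; rule definable.neg, rule assms)
  then show ?thesis by simp
qed

lemma definable_imp:
  assumes "definable P" "definable Q"
  shows "definable (\<lambda>e. P e \<longrightarrow> Q e)"
  unfolding imp_conv_disj by (rule definable_disj[OF definable.neg[OF assms(1)] assms(2)])

lemma definable_iff:
  assumes "definable P" "definable Q"
  shows "definable (\<lambda>e. P e \<longleftrightarrow> Q e)"
  unfolding iff_conv_conj_imp by (intro definable.conj definable_imp assms)

lemma definable_term_var: "definable_term (\<lambda>e. e i)"
  unfolding definable_term_def using definable.eq[of "Inl 0" "Inl (Suc i)"] by simp

lemma definable_term_const: "definable_term (\<lambda>e. c)"
  unfolding definable_term_def using definable.eq[of "Inl 0" "Inr c"] by simp

lemma definable_const: "definable (\<lambda>e. c)"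
  using definable.eq[of "Inl 0" "Inl 0"] definable.neg[OF definable.eq[of "Inl 0" "Inl 0"]] by (cases c) auto

lemma definable_term_shift: "definable_term t \<Longrightarrow> definable_term (\<lambda>e. t (\<lambda>i. e (Suc i)))"
  unfolding definable_term_def by (drule definable_rename[where h = "case_nat 0 (\<lambda>i. Suc (Suc i))"]) simp

text \<open>Rewriting \<open>R (t e)\<close> as \<open>\<exists>x. x = t e \<and> R x\<close> uses
  only the graph of \<open>t\<close>. The same device serves for more arguments and for nested
  terms.\<close>

lemma definable_subst1:
  assumes "definable (\<lambda>e. R (e 0))" and "definable_term t"
  shows "definable (\<lambda>e. R (t e))"
proof -
  have "definable (\<lambda>e. \<exists>x. x = t e \<and> R x)"
    by (rule definable_ex, rule definable.conj) (use assms in \<open>simp_all add: definable_term_def\<close>)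
  then show ?thesis by simp
qed

lemma definable_subst2:
  assumes R: "definable (\<lambda>e. R (e 0) (e 1))" and t: "definable_term t" and u: "definable_term u"
  shows "definable (\<lambda>e. R (t e) (u e))"
proof -
  have "definable (\<lambda>e. \<exists>x. x = t e \<and> (\<exists>y. y = u e \<and> R x y))"
    \<comment> \<open>Under both quantifiers the inner \<open>y\<close> is variable 0 and
      \<open>x\<close> is variable 1, hence the exchange of positions in \<open>R\<close>.\<close>
    using t definable_term_shift[OF u] definable_rename[OF R, of "\<lambda>i. if i = 0 then 1 else 0"]
    by (intro definable_ex definable.conj) (simp_all add: definable_term_def)
  then show ?thesis by simp
qed

lemma definable_subst3:
  assumes R: "definable (\<lambda>e. R (e 0) (e 1) (e 2))" and t: "definable_term t" and u: "definable_term u" and v: "definable_term v"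
  shows "definable (\<lambda>e. R (t e) (u e) (v e))"
proof -
  have "definable (\<lambda>e. \<exists>x. x = t e \<and> (\<exists>y. y = u e \<and> (\<exists>z. z = v e \<and> R x y z)))"
    using t definable_term_shift[OF u] definable_term_shift[OF definable_term_shift[OF v]]
      definable_rename[OF R, of "\<lambda>i. if i = 0 then 2 else if i = 1 then 1 else 0"]
    by (intro definable_ex definable.conj) (simp_all add: definable_term_def numeral_2_eq_2)
  then show ?thesis by simp
qed

lemma definable_mem:
  assumes "definable_term t" and "definable_term u"
  shows "definable (\<lambda>e. t e \<in>\<^sub>m u e)"
  by (rule definable_subst2[where R = "(\<in>\<^sub>m)", OF _ assms])
    (use definable.mem[of "Inl 0" "Inl 1"] in simp)

lemma definable_eq:
  assumes "definable_term t" and "definable_term u"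
  shows "definable (\<lambda>e. t e = u e)"
  by (rule definable_subst2[where R = "(=)", OF _ assms]) (use definable.eq[of "Inl 0" "Inl 1"] in simp)

lemma definable_term_subst1:
  assumes F: "definable_term (\<lambda>e. F (e 0))" and t: "definable_term t"
  shows "definable_term (\<lambda>e. F (t e))"
  unfolding definable_term_def
  by (rule definable_subst2[where R = "\<lambda>x y. x = F y", OF _ definable_term_var definable_term_shift[OF t]])
    (use F in \<open>simp add: definable_term_def\<close>)

lemma definable_term_subst2:
  assumes F: "definable_term (\<lambda>e. F (e 0) (e 1))" and t: "definable_term t" and u: "definable_term u"
  shows "definable_term (\<lambda>e. F (t e) (u e))"
  unfolding definable_term_def
  by (rule definable_subst3[where R = "\<lambda>x y z. x = F y z", OF _ definable_term_var definable_term_shift[OF t] definable_term_shift[OF u]])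
    (use F in \<open>simp add: definable_term_def numeral_2_eq_2\<close>)

lemmas definable_logic = definable.neg definable.conj definable_disj definable_imp definable_iff definable_all definable_ex definable_const
  definable_mem definable_eq definable_term_var definable_term_const

end

context ZF
begin

subsection \<open>Instances of Separation and Replacement\<close>

lemma sep_ex:
  assumes "definable (\<lambda>e. P (e 0))"
  shows "\<exists>y. \<forall>u. u \<in>\<^sub>m y \<longleftrightarrow> u \<in>\<^sub>m x \<and> P u"
proof -
  obtain p s where p: "\<And>e. P (e 0) \<longleftrightarrow> sat (mix e s) p"
    using definable_sat[OF assms] by blast
  define e where "e = (\<lambda>i::nat. undefined :: 'a)"
  \<comment> \<open>Variable 0 is even, so overwriting it changes the environment and leaves the
    parameters alone.\<close>
  have "(mix e s)(0 := u) = mix (e(0 := u)) s" for u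
    by (auto simp: fun_eq_iff mix_def elim!: evenE)
  then have "P u \<longleftrightarrow> sat ((mix e s)(0 := u)) p" for u
    using p[of "e(0 := u)"] by simp
  then show ?thesis
    using separation[of x "mix e s" 0 p] by simp
qed

definition sep :: "'a \<Rightarrow> ('a \<Rightarrow> bool) \<Rightarrow> 'a" where
  "sep x P = (THE y. \<forall>u. u \<in>\<^sub>m y \<longleftrightarrow> u \<in>\<^sub>m x \<and> P u)"

lemma mem_sep: "definable (\<lambda>e. P (e 0)) \<Longrightarrow> u \<in>\<^sub>m sep x P \<longleftrightarrow> u \<in>\<^sub>m x \<and> P u"
  unfolding sep_def by (rule the_ext) (rule sep_ex)

text \<open>Unfolding an equation \<open>y = F x\<close> to membership makes the graph of
  \<open>F\<close> definable once membership in \<open>F x\<close> is characterised.\<close>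

lemma mem_eq_iff: "x = y \<longleftrightarrow> (\<forall>u. u \<in>\<^sub>m x \<longleftrightarrow> u \<in>\<^sub>m y)"
  using extensionality by blast

lemma definable_term_upair: "definable_term t \<Longrightarrow> definable_term u \<Longrightarrow> definable_term (\<lambda>e. upair (t e) (u e))"
proof (rule definable_term_subst2[where F = upair])
  show "definable_term (\<lambda>e. upair (e 0) (e 1))"
    unfolding definable_term_def mem_eq_iff mem_upair by (intro definable_logic)
qed

lemma definable_term_opair: "definable_term t \<Longrightarrow> definable_term u \<Longrightarrow> definable_term (\<lambda>e. opair (t e) (u e))"
  unfolding opair_def by (intro definable_term_upair)

lemma definable_term_succ: "definable_term t \<Longrightarrow> definable_term (\<lambda>e. succ (t e))"
proof (rule definable_term_subst1[where F = succ])
  show "definable_term (\<lambda>e. succ (e 0))"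
    unfolding definable_term_def mem_eq_iff mem_succ by (intro definable_logic)
qed

lemmas definable_set = definable_logic definable_term_upair definable_term_opair definable_term_succ

text \<open>Kuratowski pairs of elements of \<open>C\<close> lie in the double power set of \<open>C\<close>.\<close>

lemma rel_ex:
  assumes R: "definable (\<lambda>e. R (e 0) (e 1))"
  shows "\<exists>g. \<forall>q. q \<in>\<^sub>m g \<longleftrightarrow> (\<exists>c d. q = opair c d \<and> c \<in>\<^sub>m x \<and> d \<in>\<^sub>m y \<and> R c d)"
proof -
  obtain C where C: "\<And>u. u \<in>\<^sub>m C \<longleftrightarrow> u \<in>\<^sub>m x \<or> u \<in>\<^sub>m y"
    using mem_union[of _ "upair x y"] by (metis mem_upair)
  obtain D where D: "\<And>u. u \<in>\<^sub>m D \<longleftrightarrow> u \<subseteq>\<^sub>m C" using power_set[of C] by blast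
  obtain E where E: "\<And>u. u \<in>\<^sub>m E \<longleftrightarrow> u \<subseteq>\<^sub>m D" using power_set[of D] by blast
  have "opair c d \<in>\<^sub>m E" if "c \<in>\<^sub>m x" "d \<in>\<^sub>m y" for c d
    using that by (auto simp: E D C opair_def subset_def mem_upair)
  moreover have "definable (\<lambda>e. \<exists>c d. e 0 = opair c d \<and> c \<in>\<^sub>m x \<and> d \<in>\<^sub>m y \<and> R c d)"
    by (intro definable_set definable_subst2[where R = R, OF R])
  then obtain g where "\<forall>q. q \<in>\<^sub>m g \<longleftrightarrow> q \<in>\<^sub>m E \<and> (\<exists>c d. q = opair c d \<and> c \<in>\<^sub>m x \<and> d \<in>\<^sub>m y \<and> R c d)"
    using sep_ex[of "\<lambda>q. \<exists>c d. q = opair c d \<and> c \<in>\<^sub>m x \<and> d \<in>\<^sub>m y \<and> R c d" E] by blast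
  ultimately show ?thesis by blast
qed

subsection \<open>Natural numbers and finite sets\<close>

lemma not_mem_self: "\<not> x \<in>\<^sub>m x"
  using foundation[of "upair x x"] by (auto simp: mem_upair)

lemma eq_zero_iff: "x = zero \<longleftrightarrow> (\<forall>u. \<not> u \<in>\<^sub>m x)"
  by (simp add: mem_eq_iff mem_zero)

lemma inductive_ex: "\<exists>I. is_inductive I"
proof -
  obtain I e where "e \<in>\<^sub>m I" "\<forall>u. \<not> u \<in>\<^sub>m e"
    and s: "\<And>a. a \<in>\<^sub>m I \<Longrightarrow> \<exists>b. b \<in>\<^sub>m I \<and> (\<forall>u. u \<in>\<^sub>m b \<longleftrightarrow> u \<in>\<^sub>m a \<or> u = a)"
    using infinity by blast
  then have "zero \<in>\<^sub>m I" by (simp flip: eq_zero_iff)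
  moreover have "succ a \<in>\<^sub>m I" if a: "a \<in>\<^sub>m I" for a
  proof -
    obtain b where "b \<in>\<^sub>m I" "\<forall>u. u \<in>\<^sub>m b \<longleftrightarrow> u \<in>\<^sub>m a \<or> u = a" using s[OF a] by blast
    then show ?thesis using mem_eq_iff[of b "succ a"] by (simp add: mem_succ)
  qed
  ultimately show ?thesis unfolding is_inductive_def by blast
qed

text \<open>\<open>omega\<close> is a HOL set; as an element of the structure it can occur in
  definable predicates.\<close>

definition om :: 'a where
  "om = (THE w. \<forall>u. u \<in>\<^sub>m w \<longleftrightarrow> u \<in> omega)"

lemma mem_om: "u \<in>\<^sub>m om \<longleftrightarrow> u \<in> omega"
  unfolding om_def
proof (rule the_ext)
  obtain I where I: "is_inductive I" using inductive_ex by blast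
  have "definable (\<lambda>e. \<forall>J. is_inductive J \<longrightarrow> e 0 \<in>\<^sub>m J)"
    unfolding is_inductive_def by (intro definable_set)
  from sep_ex[of "\<lambda>m. \<forall>J. is_inductive J \<longrightarrow> m \<in>\<^sub>m J", OF this, of I]
  show "\<exists>y. \<forall>u. u \<in>\<^sub>m y \<longleftrightarrow> u \<in> omega"
    using I by (auto simp: omega_def)
qed

lemma zero_omega: "zero \<in> omega"
  by (simp add: omega_def is_inductive_def)

lemma succ_omega: "m \<in> omega \<Longrightarrow> succ m \<in> omega"
  by (simp add: omega_def is_inductive_def)

lemma vN_omega: "vN n \<in> omega"
  by (induction n) (auto simp: zero_omega succ_omega)

text \<open>The elements of \<open>om\<close> satisfying \<open>P\<close> must form a set of the
  structure in order to be compared with \<open>omega\<close>; this is where definability enters.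
  HOL induction would miss nonstandard numbers.\<close>

lemma omega_induct [consumes 1, case_names zero succ]:
  assumes m: "m \<in> omega" and d: "definable (\<lambda>e. P (e 0))"
    and z: "P zero" and s: "\<And>m. m \<in> omega \<Longrightarrow> P m \<Longrightarrow> P (succ m)"
  shows "P m"
proof -
  have "is_inductive (sep om P)"
    using z s by (simp add: is_inductive_def mem_sep[OF d] mem_om zero_omega succ_omega)
  then show ?thesis using m by (auto simp: omega_def mem_sep[OF d])
qed

lemma omega_trans:
  assumes "m \<in> omega" "k \<in>\<^sub>m m" "j \<in>\<^sub>m k"
  shows "j \<in>\<^sub>m m"
proof -
  have "\<forall>k j. k \<in>\<^sub>m m \<and> j \<in>\<^sub>m k \<longrightarrow> j \<in>\<^sub>m m"
    using assms(1)
  proof (induction m rule: omega_induct)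
    show "definable (\<lambda>e. \<forall>k j. k \<in>\<^sub>m e 0 \<and> j \<in>\<^sub>m k \<longrightarrow> j \<in>\<^sub>m e 0)" by (intro definable_set)
  qed (auto simp: mem_zero mem_succ)
  then show ?thesis using assms by blast
qed

lemma omega_mem_succ:
  assumes "m \<in> omega" "n \<in>\<^sub>m m"
  shows "succ n \<in>\<^sub>m m \<or> succ n = m"
proof -
  have "\<forall>n. n \<in>\<^sub>m m \<longrightarrow> succ n \<in>\<^sub>m m \<or> succ n = m"
    using assms(1)
  proof (induction m rule: omega_induct)
    show "definable (\<lambda>e. \<forall>n. n \<in>\<^sub>m e 0 \<longrightarrow> succ n \<in>\<^sub>m e 0 \<or> succ n = e 0)" by (intro definable_set)
  qed (auto simp: mem_zero mem_succ)
  then show ?thesis using assms by blast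
qed

lemma omega_zero_mem: "m \<in> omega \<Longrightarrow> m = zero \<or> zero \<in>\<^sub>m m"
proof (induction m rule: omega_induct)
  show "definable (\<lambda>e. e 0 = zero \<or> zero \<in>\<^sub>m e 0)" by (intro definable_set)
qed (auto simp: mem_succ)

lemma omega_linear:
  assumes "m \<in> omega" "n \<in> omega"
  shows "m \<subseteq>\<^sub>m n \<or> n \<in>\<^sub>m m"
  using assms(2)
proof (induction n rule: omega_induct)
  show "definable (\<lambda>e. m \<subseteq>\<^sub>m e 0 \<or> e 0 \<in>\<^sub>m m)" unfolding subset_def by (intro definable_set)
  show "m \<subseteq>\<^sub>m zero \<or> zero \<in>\<^sub>m m"
    using omega_zero_mem[OF assms(1)] by (auto simp: subset_def)
  show "m \<subseteq>\<^sub>m succ n \<or> succ n \<in>\<^sub>m m" if "m \<subseteq>\<^sub>m n \<or> n \<in>\<^sub>m m" for n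
    using that omega_mem_succ[OF assms(1), of n] by (auto simp: subset_def mem_succ)
qed

text \<open>\<open>x\<close> injects into \<open>m\<close>, in a form that is trivially monotone in both arguments: \<open>g\<close> need not
  be single-valued and may relate further elements.\<close>

definition lep :: "'a \<Rightarrow> 'a \<Rightarrow> bool" where
  "lep x m \<longleftrightarrow> (\<exists>g. (\<forall>a. a \<in>\<^sub>m x \<longrightarrow> (\<exists>b. b \<in>\<^sub>m m \<and> opair a b \<in>\<^sub>m g)) \<and>
     (\<forall>a a' b. opair a b \<in>\<^sub>m g \<and> opair a' b \<in>\<^sub>m g \<longrightarrow> a = a'))"

lemma definable_lep:
  assumes "definable_term t" "definable_term u"
  shows "definable (\<lambda>e. lep (t e) (u e))"
  by (rule definable_subst2[where R = lep, OF _ assms]) (unfold lep_def, intro definable_set)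

lemma lep_mono: "lep x m \<Longrightarrow> y \<subseteq>\<^sub>m x \<Longrightarrow> m \<subseteq>\<^sub>m n \<Longrightarrow> lep y n"
  unfolding lep_def subset_def by meson

lemma lep_zero: "lep x zero \<longleftrightarrow> x = zero"
  by (auto simp: lep_def mem_zero eq_zero_iff intro: exI[of _ zero])

lemma lep_succ_remove:
  assumes "lep x (succ m)" "a \<in>\<^sub>m x" "\<And>c. c \<in>\<^sub>m y \<Longrightarrow> c \<in>\<^sub>m x \<and> c \<noteq> a"
  shows "lep y m"
proof -
  obtain g where g: "\<And>a. a \<in>\<^sub>m x \<Longrightarrow> \<exists>b. b \<in>\<^sub>m succ m \<and> opair a b \<in>\<^sub>m g"
    and inj: "\<And>a a' b. opair a b \<in>\<^sub>m g \<Longrightarrow> opair a' b \<in>\<^sub>m g \<Longrightarrow> a = a'"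
    using assms(1) unfolding lep_def by blast
  obtain b0 where b0: "b0 \<in>\<^sub>m succ m" "opair a b0 \<in>\<^sub>m g" using g[OF assms(2)] by blast
  \<comment> \<open>The point that \<open>g\<close> sends to \<open>m\<close> is redirected to
    \<open>b0\<close>, the value freed by removing \<open>a\<close>.\<close>
  define R where "R c d \<longleftrightarrow> opair c d \<in>\<^sub>m g \<and> d \<noteq> b0 \<or> d = b0 \<and> opair c m \<in>\<^sub>m g" for c d
  have "definable (\<lambda>e. R (e 0) (e 1))"
    unfolding R_def by (intro definable_set)
  from rel_ex[of R, OF this, of y m] obtain g'
    where g': "\<And>q. q \<in>\<^sub>m g' \<longleftrightarrow> (\<exists>c d. q = opair c d \<and> c \<in>\<^sub>m y \<and> d \<in>\<^sub>m m \<and> R c d)"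
    by blast
  have "\<exists>b. b \<in>\<^sub>m m \<and> opair c b \<in>\<^sub>m g'" if "c \<in>\<^sub>m y" for c
  proof -
    obtain b where b: "b \<in>\<^sub>m succ m" "opair c b \<in>\<^sub>m g" using g assms(3) \<open>c \<in>\<^sub>m y\<close> by blast
    then have "b \<noteq> b0" using inj b0(2) assms(3)[OF that] by blast
    show ?thesis
    proof (cases "b = m")
      case True
      then have "b0 \<in>\<^sub>m m" using b0 \<open>b \<noteq> b0\<close> by (auto simp: mem_succ)
      then show ?thesis using b True that by (auto simp: g' R_def opair_eq_iff)
    next
      case False
      then show ?thesis using b that \<open>b \<noteq> b0\<close> by (auto simp: g' R_def opair_eq_iff mem_succ)
    qed
  qed
  moreover have "c = c'" if "opair c d \<in>\<^sub>m g'" "opair c' d \<in>\<^sub>m g'" for c c' d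
    using that inj by (auto simp: g' R_def opair_eq_iff)
  ultimately show ?thesis unfolding lep_def by blast
qed

text \<open>An injection instead of a bijection makes closure under subsets immediate. Agreement
  with \<open>is_finite\<close> is \<open>is_finite_iff\<close>.\<close>

definition fin :: "'a \<Rightarrow> bool" where
  "fin x \<longleftrightarrow> (\<exists>m. m \<in>\<^sub>m om \<and> lep x m)"

lemma definable_fin:
  assumes "definable_term t"
  shows "definable (\<lambda>e. fin (t e))"
  by (rule definable_subst1[where R = fin, OF _ assms]) (unfold fin_def, intro definable_set definable_lep)

lemma fin_subset: "fin x \<Longrightarrow> y \<subseteq>\<^sub>m x \<Longrightarrow> fin y"
  unfolding fin_def using lep_mono[of x _ y] by (auto simp: subset_def)

text \<open>The bound \<open>m\<close> is the induction variable, with all sets below it treated at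
  once; removing a point lowers the bound by \<open>lep_succ_remove\<close>.\<close>

lemma fin_induct [consumes 1, case_names definable zero insert]:
  assumes x: "fin x" and d: "definable (\<lambda>e. P (e 0))" and z: "P zero"
    and ins: "\<And>x y a. fin y \<Longrightarrow> P y \<Longrightarrow> \<not> a \<in>\<^sub>m y \<Longrightarrow> (\<forall>c. c \<in>\<^sub>m x \<longleftrightarrow> c = a \<or> c \<in>\<^sub>m y) \<Longrightarrow> P x"
  shows "P x"
proof -
  have "\<forall>x. lep x m \<longrightarrow> P x" if "m \<in> omega" for m
    using that
  proof (induction m rule: omega_induct)
    show "definable (\<lambda>e. \<forall>x. lep x (e 0) \<longrightarrow> P x)"
      by (intro definable_set definable_lep d)
    show "\<forall>x. lep x zero \<longrightarrow> P x" by (simp add: lep_zero z)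
    fix m assume m: "m \<in> omega" and IH: "\<forall>x. lep x m \<longrightarrow> P x"
    show "\<forall>x. lep x (succ m) \<longrightarrow> P x"
    proof (intro allI impI)
      fix x assume x: "lep x (succ m)"
      show "P x"
      proof (cases "x = zero")
        case False
        then obtain a where a: "a \<in>\<^sub>m x" by (auto simp: eq_zero_iff)
        have "definable (\<lambda>e. e 0 \<noteq> a)" by (intro definable_set)
        from sep_ex[of "\<lambda>c. c \<noteq> a", OF this, of x]
        obtain y where y: "\<And>c. c \<in>\<^sub>m y \<longleftrightarrow> c \<in>\<^sub>m x \<and> c \<noteq> a" by blast
        have l: "lep y m" by (rule lep_succ_remove[OF x a]) (simp add: y)
        then have "fin y" using m by (auto simp: fin_def mem_om)
        with l IH show ?thesis using ins[of y a x] y a by blast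
      qed (simp add: z)
    qed
  qed
  then show ?thesis using x by (auto simp: fin_def mem_om)
qed

lemma equipollentI:
  assumes R: "definable (\<lambda>e. R (e 0) (e 1))"
    and l: "\<And>a. a \<in>\<^sub>m x \<Longrightarrow> \<exists>!b. b \<in>\<^sub>m y \<and> R a b"
    and r: "\<And>b. b \<in>\<^sub>m y \<Longrightarrow> \<exists>!a. a \<in>\<^sub>m x \<and> R a b"
  shows "x \<approx>\<^sub>m y"
proof -
  obtain g where g: "\<And>q. q \<in>\<^sub>m g \<longleftrightarrow> (\<exists>c d. q = opair c d \<and> c \<in>\<^sub>m x \<and> d \<in>\<^sub>m y \<and> R c d)"
    using rel_ex[OF R] by blast
  then have gp: "opair c d \<in>\<^sub>m g \<longleftrightarrow> c \<in>\<^sub>m x \<and> d \<in>\<^sub>m y \<and> R c d" for c d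
    by (auto simp: opair_eq_iff)
  have f: "is_fun g (ext x) (ext y)"
    unfolding is_fun_def
  proof (intro conjI allI impI ballI)
    show "\<exists>a\<in>ext x. \<exists>b\<in>ext y. p = opair a b" if "p \<in>\<^sub>m g" for p
      using that by (auto simp: g ext_def)
    show "\<exists>!b. opair a b \<in>\<^sub>m g" if "a \<in> ext x" for a
      using that l[of a] unfolding gp ext_def by blast
  qed
  have app: "app g a = b \<longleftrightarrow> b \<in>\<^sub>m y \<and> R a b" if "a \<in>\<^sub>m x" for a b
    using app_eq[OF f, of a b] that by (simp add: gp ext_def)
  have "bij_betw (app g) (ext x) (ext y)"
  proof (rule bij_betw_imageI)
    show "inj_on (app g) (ext x)"
    proof (rule inj_onI)
      fix a a' assume "a \<in> ext x" "a' \<in> ext x" "app g a = app g a'"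
      then show "a = a'" using app[of a "app g a"] app[of a' "app g a"] r[of "app g a"] by (auto simp: ext_def)
    qed
    show "app g ` ext x = ext y"
    proof (intro equalityI subsetI)
      show "b \<in> ext y" if "b \<in> app g ` ext x" for b using that app by (auto simp: ext_def)
      show "b \<in> app g ` ext x" if b: "b \<in> ext y" for b
      proof -
        obtain a where "a \<in>\<^sub>m x" "R a b" using r[of b] b unfolding ext_def by blast
        then show ?thesis using app[of a b] b by (auto simp: ext_def image_iff)
      qed
    qed
  qed
  with f show ?thesis unfolding equipollent_def by blast
qed

lemma is_finite_imp_fin:
  assumes "is_finite x"
  shows "fin x"
proof -
  obtain m f where m: "m \<in> omega" and f: "is_fun f (ext x) (ext m)" and bij: "bij_betw (app f) (ext x) (ext m)"
    using assms unfolding is_finite_def equipollent_def by blast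
  have "\<exists>b. b \<in>\<^sub>m m \<and> opair a b \<in>\<^sub>m f" if "a \<in>\<^sub>m x" for a
    using app_eq[OF f, of a "app f a"] bij_betwE[OF bij] that by (auto simp: ext_def)
  moreover have "a = a'" if "opair a b \<in>\<^sub>m f" "opair a' b \<in>\<^sub>m f" for a a' b
  proof -
    have "a \<in> ext x" "a' \<in> ext x"
      using f that unfolding is_fun_def by (metis opair_eq_iff)+
    moreover from this have "app f a = b" "app f a' = b" using app_eq[OF f] that by auto
    ultimately show ?thesis using bij by (auto simp: bij_betw_def inj_on_def)
  qed
  ultimately show ?thesis using m unfolding fin_def lep_def mem_om by blast
qed

text \<open>Bijectivity in bare quantifiers, without \<open>app\<close>, stays definable and can be
  used inside \<open>fin_induct\<close>.\<close>

definition bij_rel :: "('a \<Rightarrow> 'a \<Rightarrow> bool) \<Rightarrow> 'a \<Rightarrow> 'a \<Rightarrow> bool" where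
  "bij_rel R x y \<longleftrightarrow>
     (\<forall>a. a \<in>\<^sub>m x \<longrightarrow> (\<exists>b. b \<in>\<^sub>m y \<and> R a b)) \<and> (\<forall>b. b \<in>\<^sub>m y \<longrightarrow> (\<exists>a. a \<in>\<^sub>m x \<and> R a b)) \<and>
     (\<forall>a a' b b'. R a b \<and> R a' b' \<longrightarrow> (a = a' \<longleftrightarrow> b = b'))"

lemma fin_imp_is_finite:
  assumes "fin x"
  shows "is_finite x"
proof -
  define Q where "Q x m f \<longleftrightarrow> bij_rel (\<lambda>a b. opair a b \<in>\<^sub>m f) x m" for x m f
  have "\<exists>m f. m \<in>\<^sub>m om \<and> Q x m f"
    using assms
  proof (induction x rule: fin_induct)
    case definable
    show ?case unfolding Q_def bij_rel_def by (intro definable_set)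
  next
    case zero
    have "Q zero zero zero" by (simp add: Q_def bij_rel_def mem_zero)
    then show ?case using zero_omega mem_om by blast
  next
    case (insert x y a)
    then obtain m f where m: "m \<in>\<^sub>m om" and f: "Q y m f" by blast
    \<comment> \<open>The new point \<open>a\<close> is matched with \<open>m\<close>, the last
      element of \<open>succ m\<close>.\<close>
    define R where "R c d \<longleftrightarrow> c \<in>\<^sub>m y \<and> d \<in>\<^sub>m m \<and> opair c d \<in>\<^sub>m f \<or> c = a \<and> d = m" for c d
    have "definable (\<lambda>e. R (e 0) (e 1))"
      unfolding R_def by (intro definable_set)
    from rel_ex[of R, OF this, of x "succ m"] obtain g
      where g: "\<And>q. q \<in>\<^sub>m g \<longleftrightarrow> (\<exists>c d. q = opair c d \<and> c \<in>\<^sub>m x \<and> d \<in>\<^sub>m succ m \<and> R c d)"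
      by blast
    then have gR: "opair c d \<in>\<^sub>m g \<longleftrightarrow> R c d" for c d
      using insert by (auto simp: opair_eq_iff R_def mem_succ)
    have ff: "\<And>a. a \<in>\<^sub>m y \<Longrightarrow> \<exists>b. b \<in>\<^sub>m m \<and> opair a b \<in>\<^sub>m f"
      "\<And>b. b \<in>\<^sub>m m \<Longrightarrow> \<exists>a. a \<in>\<^sub>m y \<and> opair a b \<in>\<^sub>m f"
      "\<And>a a' b b'. opair a b \<in>\<^sub>m f \<Longrightarrow> opair a' b' \<in>\<^sub>m f \<Longrightarrow> (a = a' \<longleftrightarrow> b = b')"
      using f unfolding Q_def bij_rel_def by blast+
    have "Q x (succ m) g"
      unfolding Q_def bij_rel_def gR
    proof (intro conjI allI impI)
      show "\<exists>b. b \<in>\<^sub>m succ m \<and> R c b" if "c \<in>\<^sub>m x" for c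
        using that insert.hyps(3) ff(1)[of c] by (auto simp: mem_succ R_def)
      show "\<exists>c. c \<in>\<^sub>m x \<and> R c b" if "b \<in>\<^sub>m succ m" for b
        using that insert.hyps(3) ff(2)[of b] by (auto simp: mem_succ R_def)
      show "c = c' \<longleftrightarrow> b = b'" if "R c b \<and> R c' b'" for c c' b b'
        using that ff(3)[of c b c' b'] insert.hyps(2) not_mem_self by (auto simp: R_def)
    qed
    moreover have "succ m \<in>\<^sub>m om" using m succ_omega by (simp add: mem_om)
    ultimately show ?case by blast
  qed
  then obtain m f where m: "m \<in> omega" and f: "Q x m f" by (auto simp: mem_om)
  have "definable (\<lambda>e. opair (e 0) (e 1) \<in>\<^sub>m f)" by (intro definable_set)
  then have "x \<approx>\<^sub>m m"
    by (rule equipollentI) (use f in \<open>unfold Q_def bij_rel_def, blast+\<close>)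
  with m show ?thesis unfolding is_finite_def by blast
qed

lemma is_finite_iff: "is_finite x \<longleftrightarrow> fin x"
  using is_finite_imp_fin fin_imp_is_finite by blast

lemma insert_ex: "\<exists>x. \<forall>c. c \<in>\<^sub>m x \<longleftrightarrow> c = a \<or> c \<in>\<^sub>m y"
  by (intro exI[of _ "union (upair (upair a a) y)"]) (auto simp: mem_union mem_upair)

lemma remove_ex: "\<exists>y. \<forall>c. c \<in>\<^sub>m y \<longleftrightarrow> c \<in>\<^sub>m x \<and> c \<noteq> a"
  by (rule sep_ex) (intro definable_set)

lemma fin_zero: "fin zero"
  unfolding fin_def using lep_zero zero_omega mem_om by blast

lemma fin_insert:
  assumes "fin y" and x: "\<And>c. c \<in>\<^sub>m x \<Longrightarrow> c = a \<or> c \<in>\<^sub>m y"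
  shows "fin x"
proof -
  obtain m g where m: "m \<in>\<^sub>m om" and l: "\<And>c. c \<in>\<^sub>m y \<Longrightarrow> \<exists>b. b \<in>\<^sub>m m \<and> opair c b \<in>\<^sub>m g"
    and inj: "\<And>c c' b. opair c b \<in>\<^sub>m g \<Longrightarrow> opair c' b \<in>\<^sub>m g \<Longrightarrow> c = c'"
    using assms(1) unfolding fin_def lep_def by blast
  define R where "R c d \<longleftrightarrow> opair c d \<in>\<^sub>m g \<and> d \<in>\<^sub>m m \<or> c = a \<and> d = m" for c d
  have "definable (\<lambda>e. R (e 0) (e 1))"
    unfolding R_def by (intro definable_set)
  from rel_ex[of R, OF this, of x "succ m"] obtain g'
    where g': "\<And>q. q \<in>\<^sub>m g' \<longleftrightarrow> (\<exists>c d. q = opair c d \<and> c \<in>\<^sub>m x \<and> d \<in>\<^sub>m succ m \<and> R c d)"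
    by blast
  have "\<exists>b. b \<in>\<^sub>m succ m \<and> opair c b \<in>\<^sub>m g'" if "c \<in>\<^sub>m x" for c
    using x[OF that] l[of c] that by (auto simp: g' R_def opair_eq_iff mem_succ)
  moreover have "c = c'" if "opair c d \<in>\<^sub>m g'" "opair c' d \<in>\<^sub>m g'" for c c' d
    using that inj not_mem_self by (auto simp: g' R_def opair_eq_iff)
  moreover have "succ m \<in>\<^sub>m om" using m succ_omega by (simp add: mem_om)
  ultimately show ?thesis unfolding fin_def lep_def by blast
qed

lemma fin_subsingleton: "(\<And>c. c \<in>\<^sub>m x \<Longrightarrow> c = a) \<Longrightarrow> fin x"
  by (rule fin_insert[OF fin_zero]) blast

lemma fin_Un:
  assumes "fin x" "fin y" "\<And>c. c \<in>\<^sub>m z \<Longrightarrow> c \<in>\<^sub>m x \<or> c \<in>\<^sub>m y"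
  shows "fin z"
proof -
  have "\<forall>z. (\<forall>c. c \<in>\<^sub>m z \<longrightarrow> c \<in>\<^sub>m x \<or> c \<in>\<^sub>m y) \<longrightarrow> fin z"
    using assms(1)
  proof (induction x rule: fin_induct)
    case definable
    show ?case by (intro definable_set definable_fin)
  next
    case zero
    show ?case using fin_subset[OF assms(2)] by (auto simp: mem_zero subset_def)
  next
    case (insert x x' a)
    show ?case
    proof (intro allI impI)
      fix z assume z: "\<forall>c. c \<in>\<^sub>m z \<longrightarrow> c \<in>\<^sub>m x \<or> c \<in>\<^sub>m y"
      obtain z' where z': "\<And>c. c \<in>\<^sub>m z' \<longleftrightarrow> c \<in>\<^sub>m z \<and> c \<noteq> a" using remove_ex by blast
      then have "fin z'" using insert z by blast
      then show "fin z" by (rule fin_insert[of _ _ a]) (auto simp: z')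
    qed
  qed
  then show ?thesis using assms(3) by blast
qed

text \<open>Induction over \<open>I\<close> splits off the fibre of the newest index and adds it
  back by \<open>fin_Un\<close>. Finiteness of a fibre is stated for all its subsets, so that it
  need not be named as a set; \<open>Y\<close> is generalised because it shrinks with the
  indices.\<close>

lemma fin_fibres:
  assumes I: "fin I" and R: "definable (\<lambda>e. R (e 0) (e 1))"
    and cov: "\<And>p. p \<in>\<^sub>m Y \<Longrightarrow> \<exists>i. i \<in>\<^sub>m I \<and> R p i"
    and fib: "\<And>i z. i \<in>\<^sub>m I \<Longrightarrow> (\<And>p. p \<in>\<^sub>m z \<Longrightarrow> p \<in>\<^sub>m Y \<and> R p i) \<Longrightarrow> fin z"
  shows "fin Y"
proof -
  have "\<forall>Y. (\<forall>p. p \<in>\<^sub>m Y \<longrightarrow> (\<exists>i. i \<in>\<^sub>m I \<and> R p i)) \<and>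
      (\<forall>i z. i \<in>\<^sub>m I \<and> (\<forall>p. p \<in>\<^sub>m z \<longrightarrow> p \<in>\<^sub>m Y \<and> R p i) \<longrightarrow> fin z) \<longrightarrow> fin Y"
    using I
  proof (induction I rule: fin_induct)
    case definable
    show ?case by (intro definable_set definable_fin definable_subst2[where R = R, OF R])
  next
    case zero
    show ?case using fin_zero eq_zero_iff by (metis mem_zero)
  next
    case (insert I J a)
    show ?case
    proof (intro allI impI, elim conjE)
      fix Y
      assume cov: "\<forall>p. p \<in>\<^sub>m Y \<longrightarrow> (\<exists>i. i \<in>\<^sub>m I \<and> R p i)"
        and fib: "\<forall>i z. i \<in>\<^sub>m I \<and> (\<forall>p. p \<in>\<^sub>m z \<longrightarrow> p \<in>\<^sub>m Y \<and> R p i) \<longrightarrow> fin z"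
      have dR: "definable (\<lambda>e. R (e 0) a)" by (intro definable_set definable_subst2[where R = R, OF R])
      obtain Y1 where Y1: "\<And>p. p \<in>\<^sub>m Y1 \<longleftrightarrow> p \<in>\<^sub>m Y \<and> R p a"
        using sep_ex[of "\<lambda>p. R p a", OF dR] by blast
      obtain Y2 where Y2: "\<And>p. p \<in>\<^sub>m Y2 \<longleftrightarrow> p \<in>\<^sub>m Y \<and> \<not> R p a"
        using sep_ex[of "\<lambda>p. \<not> R p a", OF definable.neg[OF dR]] by blast
      have "fin Y1" using fib Y1 insert.hyps by blast
      moreover have "fin Y2"
      proof -
        have "\<exists>i. i \<in>\<^sub>m J \<and> R p i" if "p \<in>\<^sub>m Y2" for p
          using that cov Y2 insert.hyps by metis
        moreover have "fin z" if "i \<in>\<^sub>m J" "\<forall>p. p \<in>\<^sub>m z \<longrightarrow> p \<in>\<^sub>m Y2 \<and> R p i" for i z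
          using that fib Y2 insert.hyps by metis
        ultimately show ?thesis using insert.IH by blast
      qed
      ultimately show "fin Y" by (rule fin_Un) (auto simp: Y1 Y2)
    qed
  qed
  then show ?thesis using cov fib by blast
qed

section \<open>Cardinalities that are standard natural numbers\<close>

definition has_card :: "nat \<Rightarrow> 'a \<Rightarrow> bool" where
  "has_card n z \<longleftrightarrow> finite (ext z) \<and> card (ext z) = n"

lemma has_card_0: "has_card 0 z \<longleftrightarrow> z = zero"
  by (auto simp: has_card_def ext_def eq_zero_iff)

text \<open>Peeling off one point expresses a HOL cardinality in first-order terms, which makes
  \<open>has_card n\<close> definable for each fixed \<open>n\<close>.\<close>

lemma has_card_Suc: "has_card (Suc n) z \<longleftrightarrow> (\<exists>a y. \<not> a \<in>\<^sub>m y \<and> (\<forall>c. c \<in>\<^sub>m z \<longleftrightarrow> c = a \<or> c \<in>\<^sub>m y) \<and> has_card n y)"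
proof
  assume z: "has_card (Suc n) z"
  then obtain a where a: "a \<in>\<^sub>m z" by (auto simp: has_card_def ext_def card_Suc_eq)
  obtain y where y: "\<And>c. c \<in>\<^sub>m y \<longleftrightarrow> c \<in>\<^sub>m z \<and> c \<noteq> a" using remove_ex by blast
  have "ext y = ext z - {a}" by (auto simp: ext_def y)
  then have "has_card n y" using z a by (simp add: has_card_def ext_def)
  then show "\<exists>a y. \<not> a \<in>\<^sub>m y \<and> (\<forall>c. c \<in>\<^sub>m z \<longleftrightarrow> c = a \<or> c \<in>\<^sub>m y) \<and> has_card n y" using a y by blast
next
  assume "\<exists>a y. \<not> a \<in>\<^sub>m y \<and> (\<forall>c. c \<in>\<^sub>m z \<longleftrightarrow> c = a \<or> c \<in>\<^sub>m y) \<and> has_card n y"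
  then obtain a y where "\<not> a \<in>\<^sub>m y" "\<And>c. c \<in>\<^sub>m z \<longleftrightarrow> c = a \<or> c \<in>\<^sub>m y" and y: "has_card n y" by blast
  then have "ext z = insert a (ext y)" "a \<notin> ext y" by (auto simp: ext_def)
  then show "has_card (Suc n) z" using y by (simp add: has_card_def)
qed

lemma definable_has_card0: "definable (\<lambda>e. has_card n (e 0))"
proof (induction n)
  case 0
  show ?case unfolding has_card_0 by (intro definable_set)
next
  case (Suc n)
  show ?case unfolding has_card_Suc by (intro definable_set Suc)
qed

lemma definable_has_card: "definable_term t \<Longrightarrow> definable (\<lambda>e. has_card n (t e))"
  by (rule definable_subst1[where R = "has_card n", OF definable_has_card0])

lemma has_card_fin: "has_card n z \<Longrightarrow> fin z"
proof (induction n arbitrary: z)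
  case 0
  then show ?case by (simp add: has_card_0 fin_zero)
next
  case (Suc n)
  then show ?case unfolding has_card_Suc by (metis fin_insert)
qed

lemma ext_vN_Suc: "ext (vN (Suc n)) = insert (vN n) (ext (vN n))"
  by (auto simp: ext_def mem_succ)

lemma has_card_vN: "has_card n (vN n)"
proof (induction n)
  case 0
  show ?case by (simp add: has_card_0)
next
  case (Suc n)
  then show ?case
    using not_mem_self unfolding has_card_def ext_vN_Suc by (simp add: ext_def)
qed

text \<open>Finitely many pairs can be listed with their components as parameters. This carries a
  HOL bijection between sets with finitely many members into the structure.\<close>

lemma definable_finite_graph: "finite S \<Longrightarrow> definable (\<lambda>e. (e 0, e 1) \<in> S)"
proof (induction S rule: finite_induct)
  case empty
  show ?case by (simp add: definable_const)
next
  case (insert q S)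
  have "(e 0, e 1) \<in> insert q S \<longleftrightarrow> (e 0 = fst q \<and> e 1 = snd q) \<or> (e 0, e 1) \<in> S" for e :: "nat \<Rightarrow> 'a"
    by auto
  moreover have "definable (\<lambda>e. (e 0 = fst q \<and> e 1 = snd q) \<or> (e 0, e 1) \<in> S)"
    by (intro definable_set insert.IH)
  ultimately show ?case by simp
qed

lemma equipollent_vN_iff: "z \<approx>\<^sub>m vN n \<longleftrightarrow> has_card n z"
proof
  assume "z \<approx>\<^sub>m vN n"
  then obtain f where "bij_betw (app f) (ext z) (ext (vN n))" unfolding equipollent_def by blast
  then show "has_card n z"
    using has_card_vN[of n] bij_betw_finite bij_betw_same_card unfolding has_card_def by metis
next
  assume z: "has_card n z"
  then obtain h where h: "bij_betw h (ext z) (ext (vN n))"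
    using finite_same_card_bij has_card_vN[of n] unfolding has_card_def by metis
  define R where "R c d \<longleftrightarrow> (c, d) \<in> (\<lambda>c. (c, h c)) ` ext z" for c d
  have dR: "definable (\<lambda>e. R (e 0) (e 1))"
    unfolding R_def using z by (intro definable_finite_graph) (simp add: has_card_def)
  have R: "R c d \<longleftrightarrow> c \<in> ext z \<and> d = h c" for c d by (auto simp: R_def)
  show "z \<approx>\<^sub>m vN n"
  proof (rule equipollentI[OF dR])
    show "\<exists>!b. b \<in>\<^sub>m vN n \<and> R a b" if "a \<in>\<^sub>m z" for a
      using that bij_betwE[OF h] by (auto simp: R ext_def)
    show "\<exists>!a. a \<in>\<^sub>m z \<and> R a b" if "b \<in>\<^sub>m vN n" for b
      using that bij_betw_imp_surj_on[OF h] bij_betw_imp_inj_on[OF h]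
      by (auto simp: R ext_def inj_on_def image_iff set_eq_iff)
  qed
qed

text \<open>A set of nonstandard finite cardinality has infinitely many members in HOL and must
  count as large, whence the negated form on the right.\<close>

lemma finite_card_gt_vN_iff:
  "finite_card_gt (vN n) z \<longleftrightarrow> fin z \<and> \<not> (finite (ext z) \<and> card (ext z) \<le> n)"
proof
  assume "finite_card_gt (vN n) z"
  then obtain m where m: "m \<in> omega" "vN n \<in>\<^sub>m m" "z \<approx>\<^sub>m m" unfolding finite_card_gt_def by blast
  then have "fin z" using is_finite_imp_fin is_finite_def by blast
  moreover have "card (ext z) > n" if "finite (ext z)"
  proof -
    obtain f where f: "bij_betw (app f) (ext z) (ext m)"
      using m unfolding equipollent_def by blast
    \<comment> \<open>Transitivity gives \<open>m\<close> all elements of \<open>vN n\<close>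
      besides \<open>vN n\<close> itself, hence \<open>n + 1\<close> members.\<close>
    have "ext (vN (Suc n)) \<subseteq> ext m"
      using omega_trans[OF m(1,2)] m(2) by (auto simp: ext_def mem_succ)
    moreover have "finite (ext m)" using that f bij_betw_finite by blast
    ultimately have "card (ext (vN (Suc n))) \<le> card (ext m)" by (intro card_mono)
    then show ?thesis
      using has_card_vN[of "Suc n"] bij_betw_same_card[OF f] by (simp add: has_card_def)
  qed
  ultimately show "fin z \<and> \<not> (finite (ext z) \<and> card (ext z) \<le> n)" by auto
next
  assume z: "fin z \<and> \<not> (finite (ext z) \<and> card (ext z) \<le> n)"
  then obtain m where m: "m \<in> omega" "z \<approx>\<^sub>m m"
    using fin_imp_is_finite is_finite_def by blast
  obtain f where f: "bij_betw (app f) (ext z) (ext m)"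
    using m unfolding equipollent_def by blast
  have "\<not> m \<subseteq>\<^sub>m vN n"
  proof
    assume "m \<subseteq>\<^sub>m vN n"
    then have "ext m \<subseteq> ext (vN n)" by (auto simp: ext_def subset_def)
    then have "finite (ext m) \<and> card (ext m) \<le> n"
      using has_card_vN[of n] card_mono finite_subset unfolding has_card_def by metis
    then show False
      using z f bij_betw_finite bij_betw_same_card by metis
  qed
  then have "vN n \<in>\<^sub>m m" using omega_linear[OF m(1) vN_omega] by blast
  then show "finite_card_gt (vN n) z" using m unfolding finite_card_gt_def by blast
qed

subsection \<open>Selections from finite sets\<close>

lemma not_fin_split:
  assumes "\<not> fin x" "definable (\<lambda>e. P (e 0))"
  obtains "\<not> fin (sep x P)" | "\<not> fin (sep x (\<lambda>u. \<not> P u))"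
  using fin_Un[of "sep x P" "sep x (\<lambda>u. \<not> P u)" x] assms(1)
    mem_sep[of P, OF assms(2)] mem_sep[of "\<lambda>u. \<not> P u", OF definable.neg[OF assms(2)]] by blast

lemma fin_least:
  assumes "fin x" and le: "definable (\<lambda>e. le (e 0) (e 1))"
    and total: "\<And>i j. i \<in>\<^sub>m x \<Longrightarrow> j \<in>\<^sub>m x \<Longrightarrow> le i j \<or> le j i"
    and trans: "\<And>i j k. le i j \<Longrightarrow> le j k \<Longrightarrow> le i k"
    and ne: "x \<noteq> zero"
  shows "\<exists>k. k \<in>\<^sub>m x \<and> (\<forall>i. i \<in>\<^sub>m x \<longrightarrow> le k i)"
proof -
  have "(\<forall>i j. i \<in>\<^sub>m x \<and> j \<in>\<^sub>m x \<longrightarrow> le i j \<or> le j i) \<and> x \<noteq> zero \<longrightarrow>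
      (\<exists>k. k \<in>\<^sub>m x \<and> (\<forall>i. i \<in>\<^sub>m x \<longrightarrow> le k i))"
    using assms(1)
  proof (induction x rule: fin_induct)
    case definable
    show ?case by (intro definable_set definable_subst2[where R = le, OF le])
  next
    case (insert x y a)
    show ?case
    proof (intro impI, elim conjE)
      assume t: "\<forall>i j. i \<in>\<^sub>m x \<and> j \<in>\<^sub>m x \<longrightarrow> le i j \<or> le j i"
      then have aa: "le a a" using insert.hyps by blast
      show "\<exists>k. k \<in>\<^sub>m x \<and> (\<forall>i. i \<in>\<^sub>m x \<longrightarrow> le k i)"
      proof (cases "y = zero")
        case True
        then show ?thesis using aa insert.hyps by (auto simp: mem_zero)
      next
        case False
        then obtain k where k: "k \<in>\<^sub>m y" "\<And>i. i \<in>\<^sub>m y \<Longrightarrow> le k i" using insert t by blast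
        then consider "le k a" | "le a k" using t insert.hyps by blast
        then show ?thesis
        proof cases
          case 1
          then show ?thesis using k insert.hyps(3) by metis
        next
          case 2
          then show ?thesis using k insert.hyps(3) aa trans by metis
        qed
      qed
    qed
  qed simp
  then show ?thesis using total ne by blast
qed

text \<open>\<open>N i\<close> consists of \<open>i\<close> and its predecessors in a tournament. Induction on \<open>m\<close>: removing one
  vertex of \<open>L\<close> together with its predecessors lowers the bound for the remaining ones.\<close>

lemma fin_bounded_degree:
  assumes N: "definable (\<lambda>e. N (e 0) (e 1))"
    and refl: "\<And>i. i \<in>\<^sub>m J \<Longrightarrow> N i i"
    and total: "\<And>i j. i \<in>\<^sub>m J \<Longrightarrow> j \<in>\<^sub>m J \<Longrightarrow> N i j \<or> N j i"
    and fin: "\<And>i z. i \<in>\<^sub>m J \<Longrightarrow> (\<And>j. j \<in>\<^sub>m z \<Longrightarrow> j \<in>\<^sub>m J \<and> N i j) \<Longrightarrow> fin z"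
    and m: "m \<in> omega"
    and L: "L \<subseteq>\<^sub>m J" "\<And>i z. i \<in>\<^sub>m L \<Longrightarrow> (\<And>j. j \<in>\<^sub>m z \<Longrightarrow> j \<in>\<^sub>m J \<and> N i j) \<Longrightarrow> lep z m"
  shows "fin L"
proof -
  \<comment> \<open>Predecessors are counted in \<open>L\<close> instead of \<open>J\<close>:
    deleting vertices lowers the count only there.\<close>
  have "\<forall>L. L \<subseteq>\<^sub>m J \<and> (\<forall>i z. i \<in>\<^sub>m L \<and> (\<forall>j. j \<in>\<^sub>m z \<longrightarrow> j \<in>\<^sub>m L \<and> N i j) \<longrightarrow> lep z m) \<longrightarrow> fin L"
    using m
  proof (induction m rule: omega_induct)
    show "definable (\<lambda>e. \<forall>L. L \<subseteq>\<^sub>m J \<and> (\<forall>i z. i \<in>\<^sub>m L \<and> (\<forall>j. j \<in>\<^sub>m z \<longrightarrow> j \<in>\<^sub>m L \<and> N i j) \<longrightarrow> lep z (e 0)) \<longrightarrow> fin L)"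
      unfolding subset_def by (intro definable_set definable_lep definable_fin definable_subst2[where R = N, OF N])
  next
    show "\<forall>L. L \<subseteq>\<^sub>m J \<and> (\<forall>i z. i \<in>\<^sub>m L \<and> (\<forall>j. j \<in>\<^sub>m z \<longrightarrow> j \<in>\<^sub>m L \<and> N i j) \<longrightarrow> lep z zero) \<longrightarrow> fin L"
    proof (intro allI impI, elim conjE)
      fix L assume L: "L \<subseteq>\<^sub>m J" "\<forall>i z. i \<in>\<^sub>m L \<and> (\<forall>j. j \<in>\<^sub>m z \<longrightarrow> j \<in>\<^sub>m L \<and> N i j) \<longrightarrow> lep z zero"
      \<comment> \<open>By reflexivity \<open>i\<close> belongs to its own count, so the bound 0
        leaves no vertex.\<close>
      have False if i: "i \<in>\<^sub>m L" for i
      proof -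
        have "\<forall>j. j \<in>\<^sub>m upair i i \<longrightarrow> j \<in>\<^sub>m L \<and> N i j"
          using i L(1) refl by (simp add: mem_upair subset_def)
        then have "lep (upair i i) zero" using L(2) i by blast
        then show False by (auto simp: lep_zero eq_zero_iff mem_upair)
      qed
      then show "fin L" using fin_subsingleton by blast
    qed
  next
    fix m
    assume IH: "\<forall>L. L \<subseteq>\<^sub>m J \<and> (\<forall>i z. i \<in>\<^sub>m L \<and> (\<forall>j. j \<in>\<^sub>m z \<longrightarrow> j \<in>\<^sub>m L \<and> N i j) \<longrightarrow> lep z m) \<longrightarrow> fin L"
    show "\<forall>L. L \<subseteq>\<^sub>m J \<and> (\<forall>i z. i \<in>\<^sub>m L \<and> (\<forall>j. j \<in>\<^sub>m z \<longrightarrow> j \<in>\<^sub>m L \<and> N i j) \<longrightarrow> lep z (succ m)) \<longrightarrow> fin L"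
    proof (intro allI impI, elim conjE)
      fix L assume LJ: "L \<subseteq>\<^sub>m J"
        and L: "\<forall>i z. i \<in>\<^sub>m L \<and> (\<forall>j. j \<in>\<^sub>m z \<longrightarrow> j \<in>\<^sub>m L \<and> N i j) \<longrightarrow> lep z (succ m)"
      show "fin L"
      proof (cases "L = zero")
        case False
        then obtain a where a: "a \<in>\<^sub>m L" by (auto simp: eq_zero_iff)
        have d: "definable (\<lambda>e. N a (e 0))" by (intro definable_set definable_subst2[where R = N, OF N])
        obtain L1 where L1: "\<And>j. j \<in>\<^sub>m L1 \<longleftrightarrow> j \<in>\<^sub>m L \<and> \<not> N a j"
          using sep_ex[of "\<lambda>j. \<not> N a j", OF definable.neg[OF d]] by blast
        obtain L2 where L2: "\<And>j. j \<in>\<^sub>m L2 \<longleftrightarrow> j \<in>\<^sub>m L \<and> N a j"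
          using sep_ex[of "\<lambda>j. N a j", OF d] by blast
        have "lep z m" if i: "i \<in>\<^sub>m L1" and z: "\<forall>j. j \<in>\<^sub>m z \<longrightarrow> j \<in>\<^sub>m L1 \<and> N i j" for i z
        proof -
          obtain z' where z': "\<And>c. c \<in>\<^sub>m z' \<longleftrightarrow> c = a \<or> c \<in>\<^sub>m z" using insert_ex by blast
          \<comment> \<open>As \<open>i\<close> is not a predecessor of \<open>a\<close>, totality
            makes \<open>a\<close> a predecessor of \<open>i\<close>. Adding \<open>a\<close> to the
            predecessors of \<open>i\<close> in \<open>L1\<close> respects the old bound, so without
            \<open>a\<close> the bound drops by one.\<close>
          have "N i a" using total[of i a] i a LJ by (auto simp: L1 subset_def)
          then have "\<forall>j. j \<in>\<^sub>m z' \<longrightarrow> j \<in>\<^sub>m L \<and> N i j" using z a z' L1 by metis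
          then have "lep z' (succ m)" using L i L1 by blast
          then show ?thesis
          proof (rule lep_succ_remove)
            show "a \<in>\<^sub>m z'" by (simp add: z')
            show "c \<in>\<^sub>m z' \<and> c \<noteq> a" if "c \<in>\<^sub>m z" for c
              using that z refl a LJ by (auto simp: z' L1 subset_def)
          qed
        qed
        moreover have "L1 \<subseteq>\<^sub>m J" using LJ L1 by (simp add: subset_def)
        ultimately have "fin L1" using IH by blast
        moreover have "fin L2" by (rule fin[of a]) (use a LJ in \<open>auto simp: subset_def L2\<close>)
        ultimately show "fin L" by (rule fin_Un) (auto simp: L1 L2)
      qed (simp add: fin_zero)
    qed
  qed
  then show ?thesis using L by (auto simp: subset_def)
qed

text \<open>In-degrees are compared through their upper bounds: \<open>lev i m\<close> says that
  \<open>m\<close> bounds the count at \<open>i\<close>, and \<open>le i j\<close> that every bound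
  for \<open>j\<close> is one for \<open>i\<close>. All elements below \<open>i\<close> share a
  bound of \<open>i\<close>, so \<open>fin_bounded_degree\<close> makes initial segments
  finite.\<close>

lemma tournament_preorder:
  assumes N: "definable (\<lambda>e. N (e 0) (e 1))"
    and refl: "\<And>i. i \<in>\<^sub>m J \<Longrightarrow> N i i"
    and total: "\<And>i j. i \<in>\<^sub>m J \<Longrightarrow> j \<in>\<^sub>m J \<Longrightarrow> N i j \<or> N j i"
    and fin: "\<And>i z. i \<in>\<^sub>m J \<Longrightarrow> (\<And>j. j \<in>\<^sub>m z \<Longrightarrow> j \<in>\<^sub>m J \<and> N i j) \<Longrightarrow> fin z"
  obtains le where "definable (\<lambda>e. le (e 0) (e 1))"
    "\<And>i j k. le i j \<Longrightarrow> le j k \<Longrightarrow> le i k"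
    "\<And>i j. le i j \<or> le j i"
    "\<And>i z. i \<in>\<^sub>m J \<Longrightarrow> (\<And>j. j \<in>\<^sub>m z \<Longrightarrow> j \<in>\<^sub>m J \<and> le j i) \<Longrightarrow> fin z"
proof
  define lev where "lev i m \<longleftrightarrow> (\<forall>z. (\<forall>j. j \<in>\<^sub>m z \<longrightarrow> j \<in>\<^sub>m J \<and> N i j) \<longrightarrow> lep z m)" for i m
  define le where "le i j \<longleftrightarrow> (\<forall>m. m \<in>\<^sub>m om \<and> lev j m \<longrightarrow> lev i m)" for i j
  have lev: "definable (\<lambda>e. lev (e 0) (e 1))"
    unfolding lev_def by (intro definable_set definable_lep definable_subst2[where R = N, OF N])
  show "definable (\<lambda>e. le (e 0) (e 1))"
    unfolding le_def by (intro definable_set definable_subst2[where R = lev, OF lev])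
  show "le i k" if "le i j" "le j k" for i j k using that unfolding le_def by blast
  have lev_mono: "lev i n" if "lev i m" "m \<subseteq>\<^sub>m n" for i m n
    using that lep_mono[of _ m _ n] unfolding lev_def by (auto simp: subset_def)
  show "le i j \<or> le j i" for i j
  proof (rule ccontr)
    assume "\<not> (le i j \<or> le j i)"
    then obtain m n where "m \<in> omega" "lev j m" "\<not> lev i m" "n \<in> omega" "lev i n" "\<not> lev j n"
      unfolding le_def mem_om by blast
    moreover from this have "m \<subseteq>\<^sub>m n \<or> n \<subseteq>\<^sub>m m"
      using omega_linear[of m n] omega_trans[of m n] unfolding subset_def by blast
    ultimately show False using lev_mono by blast
  qed
  show "fin z" if i: "i \<in>\<^sub>m J" and z: "\<And>j. j \<in>\<^sub>m z \<Longrightarrow> j \<in>\<^sub>m J \<and> le j i" for i z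
  proof -
    have d: "definable (\<lambda>e. N i (e 0))" by (intro definable_set definable_subst2[where R = N, OF N])
    obtain n where n: "\<And>j. j \<in>\<^sub>m n \<longleftrightarrow> j \<in>\<^sub>m J \<and> N i j"
      using sep_ex[of "\<lambda>j. N i j", OF d] by blast
    then have "fin n" using fin i by blast
    then obtain m where m: "m \<in> omega" "lep n m" unfolding fin_def mem_om by blast
    then have "lev i m" unfolding lev_def using lep_mono[of n m _ m] n by (auto simp: subset_def)
    then have lev: "lev j m" if "j \<in>\<^sub>m z" for j
      using z[OF that] m unfolding le_def mem_om by blast
    show ?thesis
    proof (rule fin_bounded_degree[where L = z, OF N refl total fin m(1)])
      show "z \<subseteq>\<^sub>m J" using z by (simp add: subset_def)
      show "lep y m" if "j \<in>\<^sub>m z" "\<And>k. k \<in>\<^sub>m y \<Longrightarrow> k \<in>\<^sub>m J \<and> N j k" for j y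
        using lev[OF that(1)] that(2) unfolding lev_def by blast
    qed
  qed
qed

lemma upair_commute: "upair a b = upair b a"
  by (auto simp: mem_eq_iff mem_upair)

text \<open>Two-element sets define a tournament; unless it has a vertex with infinitely many predecessors,
  its in-degrees give a preorder with finite initial segments, and \<open>K\<close> is either the level of \<open>i\<close> or
  consists of \<open>i\<close> and the least suitable one-point level.\<close>

lemma definable_selection:
  assumes J: "\<not> fin J" and Sp: "definable (\<lambda>e. Sp (e 0) (e 1))"
    and sp: "\<And>K i j. K \<subseteq>\<^sub>m J \<Longrightarrow> fin K \<Longrightarrow> i \<in>\<^sub>m K \<Longrightarrow> j \<in>\<^sub>m K \<Longrightarrow> i \<noteq> j \<Longrightarrow> \<exists>k. k \<in>\<^sub>m K \<and> Sp K k"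
  obtains J' R where "J' \<subseteq>\<^sub>m J" "\<not> fin J'" "definable (\<lambda>e. R (e 0) (e 1))"
    "\<And>i. i \<in>\<^sub>m J' \<Longrightarrow> \<exists>!K. R i K" "\<And>i K. i \<in>\<^sub>m J' \<Longrightarrow> R i K \<Longrightarrow> Sp K i"
proof (cases "\<exists>i. i \<in>\<^sub>m J \<and> \<not> fin (sep J (\<lambda>j. Sp (upair i j) j))")
  case True
  then obtain i where "i \<in>\<^sub>m J" and i: "\<not> fin (sep J (\<lambda>j. Sp (upair i j) j))" by blast
  have d: "definable (\<lambda>e. Sp (upair i (e 0)) (e 0))" by (intro definable_set definable_subst2[where R = Sp, OF Sp])
  show ?thesis
  proof (rule that[OF _ i, of "\<lambda>j K. K = upair i j"])
    show "definable (\<lambda>e. e 1 = upair i (e 0))" by (intro definable_set)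
  qed (auto simp: subset_def mem_sep[of "\<lambda>j. Sp (upair i j) j", OF d])
next
  case False
  \<comment> \<open>The edge leads to the index that \<open>Sp\<close> selects from the pair. Both
    may be selected, so \<open>N\<close> is total but perhaps not antisymmetric.\<close>
  define N where "N i j \<longleftrightarrow> j = i \<or> Sp (upair i j) j" for i j
  have N: "definable (\<lambda>e. N (e 0) (e 1))" unfolding N_def by (intro definable_set definable_subst2[where R = Sp, OF Sp])
  have pair: "Sp (upair i j) i \<or> Sp (upair i j) j" if "i \<in>\<^sub>m J" "j \<in>\<^sub>m J" "i \<noteq> j" for i j
    using sp[of "upair i j" i j] that fin_insert[OF fin_subsingleton[of "upair j j" j], of "upair i j" i]
    by (auto simp: mem_upair subset_def)
  have total: "N i j \<or> N j i" if "i \<in>\<^sub>m J" "j \<in>\<^sub>m J" for i j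
    using pair[of i j] that unfolding N_def by (auto simp: upair_commute[of j i])
  have finN: "fin z" if i: "i \<in>\<^sub>m J" and z: "\<And>j. j \<in>\<^sub>m z \<Longrightarrow> j \<in>\<^sub>m J \<and> N i j" for i z
  proof -
    have d: "definable (\<lambda>e. Sp (upair i (e 0)) (e 0))" by (intro definable_set definable_subst2[where R = Sp, OF Sp])
    have "fin (sep J (\<lambda>j. Sp (upair i j) j))" using False i by blast
    then show ?thesis
      by (rule fin_insert[of _ _ i]) (use z in \<open>auto simp: mem_sep[of "\<lambda>j. Sp (upair i j) j", OF d] N_def\<close>)
  qed
  have refl: "N i i" if "i \<in>\<^sub>m J" for i by (simp add: N_def)
  obtain le where le: "definable (\<lambda>e. le (e 0) (e 1))"
    and trans: "\<And>i j k. le i j \<Longrightarrow> le j k \<Longrightarrow> le i k"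
    and total_le: "\<And>i j. le i j \<or> le j i"
    and fin_le: "\<And>i z. i \<in>\<^sub>m J \<Longrightarrow> (\<And>j. j \<in>\<^sub>m z \<Longrightarrow> j \<in>\<^sub>m J \<and> le j i) \<Longrightarrow> fin z"
    by (rule tournament_preorder[OF N refl total finN]) (assumption | fact that | blast)+
  define E where "E i j \<longleftrightarrow> le i j \<and> le j i" for i j
  have E: "definable (\<lambda>e. E (e 0) (e 1))" unfolding E_def by (intro definable_set definable_subst2[where R = le, OF le])
  \<comment> \<open>A level with at least two members is an index set to which \<open>sp\<close>
    applies; an index alone on its level needs a partner.\<close>
  define Tw where "Tw j \<longleftrightarrow> (\<exists>k. k \<in>\<^sub>m J \<and> k \<noteq> j \<and> E j k)" for j
  have Tw: "definable (\<lambda>e. Tw (e 0))" unfolding Tw_def by (intro definable_set definable_subst2[where R = E, OF E])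
  show ?thesis
  proof (rule not_fin_split[of J Tw, OF J Tw])
    assume inf: "\<not> fin (sep J Tw)"
    define R where "R j K \<longleftrightarrow> (\<forall>k. k \<in>\<^sub>m K \<longleftrightarrow> k \<in>\<^sub>m J \<and> E j k)" for j K
    have R: "definable (\<lambda>e. R (e 0) (e 1))" unfolding R_def by (intro definable_set definable_subst2[where R = E, OF E])
    have R_ex: "\<exists>!K. R j K" for j
    proof -
      have d: "definable (\<lambda>e. E j (e 0))" by (intro definable_set definable_subst2[where R = E, OF E])
      show ?thesis
        using sep_ex[of "\<lambda>k. E j k" J, OF d] unfolding R_def by (metis extensionality)
    qed
    define S where "S j \<longleftrightarrow> (\<exists>K. R j K \<and> Sp K j)" for j
    have S: "definable (\<lambda>e. S (e 0))"
      unfolding S_def by (intro definable_set definable_subst2[where R = R, OF R] definable_subst2[where R = Sp, OF Sp])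
    note mem = mem_sep[of Tw, OF Tw] mem_sep[of S, OF S]
    show ?thesis
    proof (rule that[OF _ _ R R_ex, of "sep (sep J Tw) S"])
      show "sep (sep J Tw) S \<subseteq>\<^sub>m J" by (simp add: subset_def mem)
      show "Sp K i" if "i \<in>\<^sub>m sep (sep J Tw) S" "R i K" for i K
        using that R_ex[of i] by (auto simp: mem S_def)
      show "\<not> fin (sep (sep J Tw) S)"
      proof
        assume "fin (sep (sep J Tw) S)"
        \<comment> \<open>Every index with a twin shares its finite level with an index in
          \<open>S\<close>. Finitely many of the latter would leave only finitely many of the
          former.\<close>
        then have "fin (sep J Tw)"
        proof (rule fin_fibres[OF _ E])
          fix p assume p: "p \<in>\<^sub>m sep J Tw"
          obtain K where K: "R p K" using R_ex by blast
          obtain k where k: "k \<in>\<^sub>m J" "k \<noteq> p" "E p k" using p by (auto simp: mem Tw_def)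
          have "E p p" using total_le unfolding E_def by blast
          have "fin K" using fin_le[of p K] p K by (auto simp: mem R_def E_def)
          then obtain i where i: "i \<in>\<^sub>m K" "Sp K i"
            using sp[of K p k] p k K \<open>E p p\<close> by (auto simp: subset_def mem R_def)
          have iJ: "i \<in>\<^sub>m J" "E p i" using i(1) K by (auto simp: R_def)
          have E_eq: "E p j \<longleftrightarrow> E i j" for j using iJ(2) trans unfolding E_def by blast
          then have "R i K" using K by (simp add: R_def)
          then have "S i" using i(2) unfolding S_def by blast
          moreover have "Tw i"
          proof (cases "i = p")
            case False
            then show ?thesis using p iJ unfolding Tw_def mem E_def by blast
          qed (use p in \<open>simp add: mem\<close>)
          ultimately show "\<exists>i. i \<in>\<^sub>m sep (sep J Tw) S \<and> E p i" using iJ by (auto simp: mem)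
        next
          fix i z assume "i \<in>\<^sub>m sep (sep J Tw) S" "\<And>p. p \<in>\<^sub>m z \<Longrightarrow> p \<in>\<^sub>m sep J Tw \<and> E p i"
          then show "fin z" by (intro fin_le[of i]) (auto simp: mem E_def)
        qed
        with inf show False by blast
      qed
    qed
  next
    assume inf: "\<not> fin (sep J (\<lambda>j. \<not> Tw j))"
    define A where "A = sep J (\<lambda>j. \<not> Tw j)"
    have mem_A: "j \<in>\<^sub>m A \<longleftrightarrow> j \<in>\<^sub>m J \<and> \<not> Tw j" for j
      unfolding A_def by (rule mem_sep) (intro definable_set Tw)
    \<comment> \<open>If \<open>k\<close> is not selected from the pair of \<open>j\<close> and
      \<open>k\<close>, then \<open>pair\<close> forces \<open>j\<close> to be selected.\<close>
    define C where "C j k \<longleftrightarrow> k \<in>\<^sub>m A \<and> \<not> N j k" for j k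
    have C: "definable (\<lambda>e. C (e 0) (e 1))" unfolding C_def by (intro definable_set definable_subst2[where R = N, OF N])
    define L where "L j k \<longleftrightarrow> C j k \<and> (\<forall>k'. C j k' \<longrightarrow> le k k')" for j k
    have L: "definable (\<lambda>e. L (e 0) (e 1))"
      unfolding L_def by (intro definable_set definable_subst2[where R = C, OF C] definable_subst2[where R = le, OF le])
    define R where "R j K \<longleftrightarrow> (\<exists>k. L j k \<and> K = upair j k)" for j K
    have R: "definable (\<lambda>e. R (e 0) (e 1))"
      unfolding R_def by (intro definable_set definable_subst2[where R = L, OF L])
    have L_ex: "\<exists>k. L j k" if j: "j \<in>\<^sub>m A" for j
    proof -
      have "\<exists>c. C j c"
      proof (rule ccontr)
        assume "\<not> (\<exists>c. C j c)"
        \<comment> \<open>Otherwise all of \<open>A\<close> would consist of predecessors of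
          \<open>j\<close>.\<close>
        then have "fin A" using finN[of j A] j by (auto simp: C_def mem_A)
        with inf show False by (simp add: A_def)
      qed
      then obtain c where c: "C j c" by blast
      have "definable (\<lambda>e. C j (e 0) \<and> le (e 0) c)"
        by (intro definable_set definable_subst2[where R = C, OF C] definable_subst2[where R = le, OF le])
      \<comment> \<open>Cutting off at one candidate \<open>c\<close> leaves a finite initial
        segment, to which \<open>fin_least\<close> applies.\<close>
      then obtain z where z: "\<And>k. k \<in>\<^sub>m z \<longleftrightarrow> k \<in>\<^sub>m J \<and> C j k \<and> le k c"
        using sep_ex[of "\<lambda>k. C j k \<and> le k c" J] by blast
      have "c \<in>\<^sub>m J" using c by (simp add: C_def mem_A)
      then have finz: "fin z" using fin_le[of c z] by (auto simp: z)
      have "z \<noteq> zero" using c total_le \<open>c \<in>\<^sub>m J\<close> by (auto simp: eq_zero_iff z)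
      have "\<exists>k. k \<in>\<^sub>m z \<and> (\<forall>i. i \<in>\<^sub>m z \<longrightarrow> le k i)"
      proof (rule fin_least[OF finz le])
        show "le i j \<or> le j i" for i j by (rule total_le)
        show "le h k" if "le h i" "le i k" for h i k using that by (rule trans)
      qed fact
      then obtain k where k: "k \<in>\<^sub>m z" "\<And>i. i \<in>\<^sub>m z \<Longrightarrow> le k i" by blast
      have "le k k'" if "C j k'" for k'
      proof (cases "le k' c")
        case True
        then show ?thesis using k that by (auto simp: z C_def mem_A)
      next
        case False
        then show ?thesis using total_le[of c k'] k trans[of k c k'] by (auto simp: z)
      qed
      then show ?thesis using k(1) by (auto simp: L_def z)
    qed
    \<comment> \<open>Two least candidates lie on one level, and an element of \<open>A\<close> is
      alone on its level. The partner is thus unique without any choice.\<close>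
    have L_unique: "k = k'" if "L j k" "L j k'" for j k k'
      using that unfolding L_def C_def mem_A Tw_def E_def by blast
    show ?thesis
    proof (rule that[OF _ _ R, of A])
      show "A \<subseteq>\<^sub>m J" by (simp add: subset_def mem_A)
      show "\<not> fin A" using inf by (simp add: A_def)
      show "\<exists>!K. R j K" if "j \<in>\<^sub>m A" for j
        using L_ex[OF that] L_unique unfolding R_def by metis
      show "Sp K j" if "j \<in>\<^sub>m A" "R j K" for j K
        using that pair[of j] by (auto simp: R_def L_def C_def N_def mem_A)
    qed
  qed
qed

subsection \<open>Families of finite sets\<close>

text \<open>The function is kept as the pairs \<open>opair z w \<in>\<^sub>m f\<close>, a form that
  the definability rules cover directly.\<close>

lemma RC_finE:
  assumes "RC_fin (vN n)" "\<not> fin x"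
  obtains y f where "y \<subseteq>\<^sub>m x" "\<not> fin y"
    "\<And>z w. opair z w \<in>\<^sub>m f \<Longrightarrow> w \<subseteq>\<^sub>m z \<and> has_card n w"
    "\<And>z w w'. opair z w \<in>\<^sub>m f \<Longrightarrow> opair z w' \<in>\<^sub>m f \<Longrightarrow> w = w'"
    "\<And>z. z \<subseteq>\<^sub>m y \<Longrightarrow> fin z \<Longrightarrow> \<not> (finite (ext z) \<and> card (ext z) \<le> n) \<Longrightarrow> \<exists>w. opair z w \<in>\<^sub>m f"
proof -
  obtain y f where y: "y \<subseteq>\<^sub>m x" "\<not> is_finite y"
    and f: "is_fun f (subsets_gt y (vN n)) (subsets_card y (vN n))"
    and sub: "\<And>z. z \<in> subsets_gt y (vN n) \<Longrightarrow> app f z \<subseteq>\<^sub>m z"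
    using assms unfolding RC_fin_def is_finite_iff by blast
  have dom: "z \<in> subsets_gt y (vN n) \<and> w \<in> subsets_card y (vN n)" if "opair z w \<in>\<^sub>m f" for z w
    using f that unfolding is_fun_def by (metis opair_eq_iff)
  show ?thesis
  proof (rule that)
    show "y \<subseteq>\<^sub>m x" "\<not> fin y" using y by (simp_all add: is_finite_iff)
    show "w \<subseteq>\<^sub>m z \<and> has_card n w" if "opair z w \<in>\<^sub>m f" for z w
      using dom[OF that] sub[of z] app_eq[OF f, of z w] that
      by (simp add: subsets_card_def equipollent_vN_iff)
    show "w = w'" if "opair z w \<in>\<^sub>m f" "opair z w' \<in>\<^sub>m f" for z w w'
      using dom[OF that(1)] f that unfolding is_fun_def by blast
    show "\<exists>w. opair z w \<in>\<^sub>m f"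
      if "z \<subseteq>\<^sub>m y" "fin z" "\<not> (finite (ext z) \<and> card (ext z) \<le> n)" for z
      using f that unfolding is_fun_def subsets_gt_def finite_card_gt_vN_iff by blast
  qed
qed

text \<open>Induction over the HOL set \<open>S\<close> is external, so each \<open>P n\<close> has
  to be definable separately, not uniformly in \<open>n\<close>.\<close>

lemma not_fin_pigeonhole:
  assumes "finite S" "\<not> fin x" "\<And>n. n \<in> S \<Longrightarrow> definable (\<lambda>e. P n (e 0))"
    and "\<And>u. u \<in>\<^sub>m x \<Longrightarrow> \<exists>n\<in>S. P n u"
  shows "\<exists>n\<in>S. \<exists>y. y \<subseteq>\<^sub>m x \<and> \<not> fin y \<and> (\<forall>u. u \<in>\<^sub>m y \<longrightarrow> P n u)"
  using assms
proof (induction S arbitrary: x rule: finite_induct)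
  case empty
  then have "x = zero" unfolding eq_zero_iff by blast
  then show ?case using empty fin_zero by simp
next
  case (insert n S)
  have d: "definable (\<lambda>e. P n (e 0))" using insert.prems by blast
  note mem = mem_sep[of "P n", OF d] mem_sep[of "\<lambda>u. \<not> P n u", OF definable.neg[OF d]]
  show ?case
  proof (rule not_fin_split[of x "P n", OF insert.prems(1) d])
    assume "\<not> fin (sep x (P n))"
    moreover have "sep x (P n) \<subseteq>\<^sub>m x" "\<forall>u. u \<in>\<^sub>m sep x (P n) \<longrightarrow> P n u"
      by (simp_all add: mem subset_def)
    ultimately show ?thesis by blast
  next
    assume inf: "\<not> fin (sep x (\<lambda>u. \<not> P n u))"
    have "\<exists>m\<in>S. P m u" if "u \<in>\<^sub>m sep x (\<lambda>u. \<not> P n u)" for u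
      using that insert.prems(3)[of u] by (auto simp: mem)
    then have "\<exists>m\<in>S. \<exists>y. y \<subseteq>\<^sub>m sep x (\<lambda>u. \<not> P n u) \<and> \<not> fin y \<and> (\<forall>u. u \<in>\<^sub>m y \<longrightarrow> P m u)"
      using insert.IH[OF inf] insert.prems(2) by blast
    then show ?thesis unfolding subset_def mem by blast
  qed
qed

text \<open>A set \<open>X\<close> of pairs is regarded as the family of its fibres over the first components.\<close>

definition idx :: "'a \<Rightarrow> 'a \<Rightarrow> bool" where
  "idx p i \<longleftrightarrow> (\<exists>a. p = opair i a)"

definition fib :: "'a \<Rightarrow> 'a \<Rightarrow> 'a" where
  "fib X i = sep X (\<lambda>p. idx p i)"

lemma definable_idx:
  assumes "definable_term t" "definable_term u"
  shows "definable (\<lambda>e. idx (t e) (u e))"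
  by (rule definable_subst2[where R = idx, OF _ assms]) (unfold idx_def, intro definable_set)

lemma idx_unique: "idx p i \<Longrightarrow> idx p j \<Longrightarrow> i = j"
  by (auto simp: idx_def opair_eq_iff)

lemma mem_fib: "p \<in>\<^sub>m fib X i \<longleftrightarrow> p \<in>\<^sub>m X \<and> idx p i"
  unfolding fib_def by (rule mem_sep) (intro definable_set definable_idx)

lemma definable_term_fib:
  assumes "definable_term t" "definable_term u"
  shows "definable_term (\<lambda>e. fib (t e) (u e))"
proof (rule definable_term_subst2[where F = fib, OF _ assms])
  show "definable_term (\<lambda>e. fib (e 0) (e 1))"
    unfolding definable_term_def mem_eq_iff mem_fib by (intro definable_set definable_idx)
qed

lemmas definable_fam = definable_set definable_fin definable_idx definable_term_fib definable_has_card

text \<open>Each element has at most one index, so \<open>X\<close> covers \<open>G\<close> with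
  fibres of at most one point; this is \<open>fin_fibres\<close> with the roles exchanged.\<close>

lemma not_fin_family:
  assumes "\<not> fin G" "\<And>i. i \<in>\<^sub>m G \<Longrightarrow> \<exists>p. p \<in>\<^sub>m X \<and> idx p i"
  shows "\<not> fin X"
proof
  assume X: "fin X"
  have "fin G"
  proof (rule fin_fibres[OF X, of "\<lambda>i p. idx p i"])
    show "definable (\<lambda>e. idx (e 1) (e 0))" by (intro definable_fam)
    show "\<exists>p. p \<in>\<^sub>m X \<and> idx p i" if "i \<in>\<^sub>m G" for i using assms(2) that .
    show "fin z" if "\<And>i. i \<in>\<^sub>m z \<Longrightarrow> i \<in>\<^sub>m G \<and> idx p i" for p z
    proof (cases "z = zero")
      case False
      then obtain i where "i \<in>\<^sub>m z" by (auto simp: eq_zero_iff)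
      then show ?thesis using that idx_unique by (intro fin_subsingleton[of z i]) blast
    qed (simp add: fin_zero)
  qed
  with assms(1) show False ..
qed

lemma fin_family:
  assumes "fin G" "\<And>p. p \<in>\<^sub>m X \<Longrightarrow> \<exists>i. i \<in>\<^sub>m G \<and> idx p i" "\<And>i. i \<in>\<^sub>m G \<Longrightarrow> fin (fib X i)"
  shows "fin X"
proof (rule fin_fibres[OF assms(1), of idx])
  show "definable (\<lambda>e. idx (e 0) (e 1))" by (intro definable_fam)
  show "fin z" if "i \<in>\<^sub>m G" "\<And>p. p \<in>\<^sub>m z \<Longrightarrow> p \<in>\<^sub>m X \<and> idx p i" for i z
    using fin_subset[OF assms(3)[OF that(1)], of z] that(2) by (auto simp: subset_def mem_fib)
qed (use assms in blast)

section \<open>Splitting three-element fibres\<close>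

lemma four_splits_three:
  assumes w: "has_card 4 w" "\<And>p. p \<in>\<^sub>m w \<Longrightarrow> p \<in>\<^sub>m Y \<and> (\<exists>i. i \<in>\<^sub>m K \<and> idx p i)"
    and three: "\<And>i. i \<in>\<^sub>m K \<Longrightarrow> has_card 3 (fib Y i)"
  shows "\<exists>i p q. i \<in>\<^sub>m K \<and> p \<in>\<^sub>m w \<and> idx p i \<and> q \<in>\<^sub>m Y \<and> idx q i \<and> \<not> q \<in>\<^sub>m w"
proof (rule ccontr)
  assume "\<not> ?thesis"
  then have full: "ext (fib Y i) \<subseteq> ext w" if "i \<in>\<^sub>m K" "p \<in>\<^sub>m w" "idx p i" for i p
    using that by (auto simp: ext_def mem_fib)
  have W: "finite (ext w)" "card (ext w) = 4" using w(1) by (simp_all add: has_card_def)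
  then have "ext w \<noteq> {}" by auto
  then obtain p where "p \<in>\<^sub>m w" by (auto simp: ext_def)
  then obtain i where i: "i \<in>\<^sub>m K" "idx p i" using w(2) by blast
  then have 1: "ext (fib Y i) \<subseteq> ext w" using full \<open>p \<in>\<^sub>m w\<close> by blast
  have 3: "finite (ext (fib Y i))" "card (ext (fib Y i)) = 3" using three[OF i(1)] by (simp_all add: has_card_def)
  \<comment> \<open>One full fibre has 3 < 4 points, so \<open>w\<close> reaches a second one; two
    full fibres already have 6 > 4 points.\<close>
  have "ext w - ext (fib Y i) \<noteq> {}"
  proof
    assume "ext w - ext (fib Y i) = {}"
    then have "ext w = ext (fib Y i)" using 1 by blast
    then show False using 3 W by simp
  qed
  then obtain q where q: "q \<in>\<^sub>m w" "\<not> q \<in>\<^sub>m fib Y i" by (auto simp: ext_def)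
  then obtain j where j: "j \<in>\<^sub>m K" "idx q j" using w(2) by blast
  then have 2: "ext (fib Y j) \<subseteq> ext w" using full q by blast
  have "i \<noteq> j" using q j w(2) by (auto simp: mem_fib)
  then have "ext (fib Y i) \<inter> ext (fib Y j) = {}"
    using idx_unique by (auto simp: ext_def mem_fib)
  moreover have "finite (ext (fib Y j))" "card (ext (fib Y j)) = 3"
    using three[OF j(1)] by (simp_all add: has_card_def)
  ultimately have "card (ext (fib Y i) \<union> ext (fib Y j)) = 6" using 3 by (simp add: card_Un_disjoint)
  moreover have "card (ext (fib Y i) \<union> ext (fib Y j)) \<le> 4"
    using card_mono[OF W(1)] 1 2 W(2) by (metis Un_least)
  ultimately show False by simp
qed

lemma three_element_fibres:
  assumes J: "\<not> fin J" and three: "\<And>i. i \<in>\<^sub>m J \<Longrightarrow> has_card 3 (fib Y i)"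
    and f: "\<And>z w. opair z w \<in>\<^sub>m f \<Longrightarrow> w \<subseteq>\<^sub>m z \<and> has_card 4 w"
    and fn: "\<And>z w w'. opair z w \<in>\<^sub>m f \<Longrightarrow> opair z w' \<in>\<^sub>m f \<Longrightarrow> w = w'"
    and ex: "\<And>z. z \<subseteq>\<^sub>m Y \<Longrightarrow> fin z \<Longrightarrow> \<not> (finite (ext z) \<and> card (ext z) \<le> 4) \<Longrightarrow> \<exists>w. opair z w \<in>\<^sub>m f"
  shows "\<exists>X' G' n. X' \<subseteq>\<^sub>m Y \<and> G' \<subseteq>\<^sub>m J \<and> \<not> fin G' \<and> n \<in> {1,2} \<and> (\<forall>i. i \<in>\<^sub>m G' \<longrightarrow> has_card n (fib X' i))"
proof -
  define U where "U K z \<longleftrightarrow> (\<forall>p. p \<in>\<^sub>m z \<longleftrightarrow> p \<in>\<^sub>m Y \<and> (\<exists>i. i \<in>\<^sub>m K \<and> idx p i))" for K z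
  have U: "definable (\<lambda>e. U (e 0) (e 1))" unfolding U_def by (intro definable_fam)
  have U_ex: "\<exists>z. U K z" for K
    unfolding U_def by (rule sep_ex) (intro definable_fam)
  have U_unique: "z = z'" if "U K z" "U K z'" for K z z'
    using that unfolding U_def mem_eq_iff by blast
  \<comment> \<open>The four points chosen from the union over \<open>K\<close> include a point of
    the fibre of \<open>i\<close> and miss another.\<close>
  define Sp where "Sp K i \<longleftrightarrow> (\<exists>z w p q. U K z \<and> opair z w \<in>\<^sub>m f \<and> p \<in>\<^sub>m w \<and> idx p i \<and>
    q \<in>\<^sub>m Y \<and> idx q i \<and> \<not> q \<in>\<^sub>m w)" for K i
  have Sp: "definable (\<lambda>e. Sp (e 0) (e 1))"
    unfolding Sp_def by (intro definable_fam definable_subst2[where R = U, OF U])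
  have sp: "\<exists>k. k \<in>\<^sub>m K \<and> Sp K k"
    if K: "K \<subseteq>\<^sub>m J" "fin K" and ij: "i \<in>\<^sub>m K" "j \<in>\<^sub>m K" "i \<noteq> j" for K i j
  proof -
    have three': "has_card 3 (fib Y k)" if "k \<in>\<^sub>m K" for k using three K that by (simp add: subset_def)
    obtain z where z: "U K z" using U_ex by blast
    have "fin (fib z k)" if "k \<in>\<^sub>m K" for k
      using fin_subset[OF has_card_fin[OF three'[OF that]]] z by (simp add: subset_def mem_fib U_def)
    then have "fin z"
      using fin_family[OF K(2), of z] z by (simp add: U_def)
    moreover have "z \<subseteq>\<^sub>m Y" using z by (simp add: U_def subset_def)
    \<comment> \<open>Two distinct indices contribute 6 points, so the choice function is defined on
      the union.\<close>
    moreover have "\<not> (finite (ext z) \<and> card (ext z) \<le> 4)"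
    proof
      assume c: "finite (ext z) \<and> card (ext z) \<le> 4"
      have "ext (fib Y i) \<union> ext (fib Y j) \<subseteq> ext z"
        using z ij by (auto simp: U_def ext_def mem_fib)
      then have "card (ext (fib Y i) \<union> ext (fib Y j)) \<le> 4"
        using c card_mono by (meson order_trans)
      moreover have "ext (fib Y i) \<inter> ext (fib Y j) = {}"
        using idx_unique ij(3) by (auto simp: ext_def mem_fib)
      ultimately show False
        using three'[OF ij(1)] three'[OF ij(2)] by (simp add: has_card_def card_Un_disjoint)
    qed
    ultimately obtain w where w: "opair z w \<in>\<^sub>m f" using ex by blast
    have "\<exists>i p q. i \<in>\<^sub>m K \<and> p \<in>\<^sub>m w \<and> idx p i \<and> q \<in>\<^sub>m Y \<and> idx q i \<and> \<not> q \<in>\<^sub>m w"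
      using f[OF w] z three' by (intro four_splits_three) (auto simp: U_def subset_def)
    then show ?thesis using z w unfolding Sp_def by blast
  qed
  show ?thesis
  proof (rule definable_selection[OF J Sp])
    show "\<exists>k. k \<in>\<^sub>m K \<and> Sp K k"
      if "K \<subseteq>\<^sub>m J" "fin K" "i \<in>\<^sub>m K" "j \<in>\<^sub>m K" "i \<noteq> j" for K i j
      using that by (rule sp)
  next
    fix J' R
    assume J': "J' \<subseteq>\<^sub>m J" "\<not> fin J'" and R: "definable (\<lambda>e. R (e 0) (e 1))"
      and R_ex: "\<And>i. i \<in>\<^sub>m J' \<Longrightarrow> \<exists>!K. R i K" and R_Sp: "\<And>i K. i \<in>\<^sub>m J' \<Longrightarrow> R i K \<Longrightarrow> Sp K i"
    \<comment> \<open>Over \<open>i\<close> this keeps the part of the fibre that is chosen at the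
      index set assigned to \<open>i\<close> by \<open>R\<close>. That part is nonempty and proper,
      hence of size 1 or 2.\<close>
    define P where "P p \<longleftrightarrow> (\<exists>i K z w. idx p i \<and> R i K \<and> U K z \<and> opair z w \<in>\<^sub>m f \<and> p \<in>\<^sub>m w)" for p
    have "definable (\<lambda>e. P (e 0))"
      unfolding P_def by (intro definable_fam definable_subst2[where R = U, OF U] definable_subst2[where R = R, OF R])
    note mem = mem_sep[of P, OF this]
    have "\<exists>n\<in>{1,2}. has_card n (fib (sep Y P) i)" if i: "i \<in>\<^sub>m J'" for i
    proof -
      obtain K where K: "R i K" "\<And>K'. R i K' \<Longrightarrow> K' = K" using R_ex[OF i] by blast
      obtain z w p q where z: "U K z" "opair z w \<in>\<^sub>m f" and p: "p \<in>\<^sub>m w" "idx p i"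
        and q: "q \<in>\<^sub>m Y" "idx q i" "\<not> q \<in>\<^sub>m w"
        using R_Sp[OF i K(1)] unfolding Sp_def by blast
      have "p \<in>\<^sub>m Y" using f[OF z(2)] z(1) p by (auto simp: subset_def U_def)
      moreover have "P p" using p K z unfolding P_def by blast
      ultimately have "p \<in> ext (fib (sep Y P) i)" using p by (simp add: ext_def mem_fib mem)
      moreover have "\<not> P q" using q K z idx_unique U_unique fn unfolding P_def by metis
      then have "ext (fib (sep Y P) i) \<subset> ext (fib Y i)"
        using q by (auto simp: ext_def mem_fib mem)
      moreover have "has_card 3 (fib Y i)" using three i J' by (simp add: subset_def)
      ultimately have "finite (ext (fib (sep Y P) i))" "card (ext (fib (sep Y P) i)) < 3"
          "card (ext (fib (sep Y P) i)) \<noteq> 0"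
        using psubset_card_mono[of "ext (fib Y i)" "ext (fib (sep Y P) i)"]
        by (auto simp: has_card_def dest: finite_subset)
      then have "card (ext (fib (sep Y P) i)) = 1 \<or> card (ext (fib (sep Y P) i)) = 2" by linarith
      then show ?thesis using \<open>finite (ext (fib (sep Y P) i))\<close> unfolding has_card_def by blast
    qed
    note cards = this
    have "\<exists>n\<in>{1,2}. \<exists>G'. G' \<subseteq>\<^sub>m J' \<and> \<not> fin G' \<and> (\<forall>i. i \<in>\<^sub>m G' \<longrightarrow> has_card n (fib (sep Y P) i))"
    proof (rule not_fin_pigeonhole[where P = "\<lambda>n i. has_card n (fib (sep Y P) i)", OF _ J'(2)])
      show "definable (\<lambda>e. has_card n (fib (sep Y P) (e 0)))" for n by (intro definable_fam)
    qed (simp, rule cards)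
    then obtain n G' where "n \<in> {1,2::nat}" "G' \<subseteq>\<^sub>m J'" "\<not> fin G'" "\<forall>i. i \<in>\<^sub>m G' \<longrightarrow> has_card n (fib (sep Y P) i)"
      by blast
    moreover have "sep Y P \<subseteq>\<^sub>m Y" by (simp add: subset_def mem)
    moreover have "G' \<subseteq>\<^sub>m J" using calculation J' by (simp add: subset_def)
    ultimately show ?thesis by blast
  qed
qed

section \<open>Selections of one fixed size from infinitely many fibres\<close>

definition selectable :: "nat \<Rightarrow> nat set \<Rightarrow> bool" where
  "selectable k N \<longleftrightarrow> (\<forall>X G. \<not> fin G \<and>
     (\<forall>i. i \<in>\<^sub>m G \<longrightarrow> fin (fib X i) \<and> \<not> (finite (ext (fib X i)) \<and> card (ext (fib X i)) \<le> k)) \<longrightarrow>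
     (\<exists>X' G' n. X' \<subseteq>\<^sub>m X \<and> G' \<subseteq>\<^sub>m G \<and> \<not> fin G' \<and> n \<in> N \<and> (\<forall>i. i \<in>\<^sub>m G' \<longrightarrow> has_card n (fib X' i))))"

lemma selectable_1_2_4:
  assumes RC: "RC_fin (vN 4)"
  shows "selectable 0 {1,2,4}"
  unfolding selectable_def
proof (intro allI impI, elim conjE)
  fix X G
  assume G: "\<not> fin G"
    and *: "\<forall>i. i \<in>\<^sub>m G \<longrightarrow> fin (fib X i) \<and> \<not> (finite (ext (fib X i)) \<and> card (ext (fib X i)) \<le> 0)"
  then have fin: "fin (fib X i)" if "i \<in>\<^sub>m G" for i using that by blast
  have ne: "\<exists>p. p \<in>\<^sub>m X \<and> idx p i" if "i \<in>\<^sub>m G" for i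
  proof (rule ccontr)
    assume "\<nexists>p. p \<in>\<^sub>m X \<and> idx p i"
    then have "ext (fib X i) = {}" by (auto simp: ext_def mem_fib)
    then show False using *[rule_format, OF that] by simp
  qed
  have "definable (\<lambda>e. \<exists>i. i \<in>\<^sub>m G \<and> idx (e 0) i)" by (intro definable_fam)
  then obtain X0 where X0: "\<And>p. p \<in>\<^sub>m X0 \<longleftrightarrow> p \<in>\<^sub>m X \<and> (\<exists>i. i \<in>\<^sub>m G \<and> idx p i)"
    using sep_ex[of "\<lambda>p. \<exists>i. i \<in>\<^sub>m G \<and> idx p i" X] by blast
  have "\<not> fin X0" by (rule not_fin_family[OF G]) (use ne X0 in blast)
  from RC_finE[OF RC this] obtain Y f where Y: "Y \<subseteq>\<^sub>m X0" "\<not> fin Y"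
    and f: "\<And>z w. opair z w \<in>\<^sub>m f \<Longrightarrow> w \<subseteq>\<^sub>m z \<and> has_card 4 w"
    and fn: "\<And>z w w'. opair z w \<in>\<^sub>m f \<Longrightarrow> opair z w' \<in>\<^sub>m f \<Longrightarrow> w = w'"
    and ex: "\<And>z. z \<subseteq>\<^sub>m Y \<Longrightarrow> fin z \<Longrightarrow> \<not> (finite (ext z) \<and> card (ext z) \<le> 4) \<Longrightarrow> \<exists>w. opair z w \<in>\<^sub>m f"
    by blast
  have YX: "Y \<subseteq>\<^sub>m X" using Y X0 by (simp add: subset_def)
  have d: "definable (\<lambda>e. \<exists>p. p \<in>\<^sub>m Y \<and> idx p (e 0))" by (intro definable_fam)
  obtain H where H: "\<And>i. i \<in>\<^sub>m H \<longleftrightarrow> i \<in>\<^sub>m G \<and> (\<exists>p. p \<in>\<^sub>m Y \<and> idx p i)"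
    using sep_ex[of "\<lambda>i. \<exists>p. p \<in>\<^sub>m Y \<and> idx p i" G, OF d] by blast
  have fibY: "fin (fib Y i)" if "i \<in>\<^sub>m G" for i
    using fin_subset[OF fin[OF that]] YX by (simp add: subset_def mem_fib)
  \<comment> \<open>\<open>Y\<close> may miss whole fibres, but it meets infinitely many, because
    finitely many finite fibres have a finite union.\<close>
  have infH: "\<not> fin H"
  proof
    assume "fin H"
    then have "fin Y"
    proof (rule fin_family)
      show "\<exists>i. i \<in>\<^sub>m H \<and> idx p i" if "p \<in>\<^sub>m Y" for p
        using that Y(1) X0 H unfolding subset_def by blast
    qed (use H fibY in blast)
    with Y show False by blast
  qed
  \<comment> \<open>The value 5 stands for all sizes above 4, nonstandard ones included. Five
    definable classes thus cover the nonempty fibres.\<close>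
  define P where "P n i \<longleftrightarrow> (if n < 5 then has_card n (fib Y i) else \<not> (\<exists>k\<in>{..4}. has_card k (fib Y i)))" for n i
  have "definable (\<lambda>e. P n (e 0))" for n
  proof (cases "n < 5")
    case False
    have "{..4} = {0,1,2,3,4::nat}" by auto
    then show ?thesis unfolding P_def using False by (simp only: if_False bex_simps) (intro definable_fam)
  qed (simp add: P_def, intro definable_fam)
  moreover have "\<exists>n\<in>{1..5}. P n i" if i: "i \<in>\<^sub>m H" for i
  proof (cases "\<exists>k\<in>{..4}. has_card k (fib Y i)")
    case True
    then obtain k where k: "k \<le> 4" "has_card k (fib Y i)" by auto
    have "k \<noteq> 0" using k i by (auto simp: has_card_0 H mem_fib eq_zero_iff intro: gr0I)
    then show ?thesis using k by (intro bexI[of _ k]) (auto simp: P_def)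
  qed (auto simp: P_def)
  ultimately obtain n J where n: "n \<in> {1..5}" and J: "J \<subseteq>\<^sub>m H" "\<not> fin J" "\<And>i. i \<in>\<^sub>m J \<Longrightarrow> P n i"
    using not_fin_pigeonhole[of "{1..5}" H P] infH by blast
  have JG: "J \<subseteq>\<^sub>m G" using J(1) H by (simp add: subset_def)
  consider "n \<in> {1,2,4}" | "n = 3" | "n = 5" using n by fastforce
  then show "\<exists>X' G' n. X' \<subseteq>\<^sub>m X \<and> G' \<subseteq>\<^sub>m G \<and> \<not> fin G' \<and> n \<in> {1,2,4} \<and> (\<forall>i. i \<in>\<^sub>m G' \<longrightarrow> has_card n (fib X' i))"
  proof cases
    case 1
    then have "\<forall>i. i \<in>\<^sub>m J \<longrightarrow> has_card n (fib Y i)" using J(3) by (auto simp: P_def)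
    then show ?thesis using 1 YX JG J(2) by blast
  next
    case 2
    then have three: "has_card 3 (fib Y i)" if "i \<in>\<^sub>m J" for i using J(3)[OF that] by (simp add: P_def)
    have "\<exists>X' G' n. X' \<subseteq>\<^sub>m Y \<and> G' \<subseteq>\<^sub>m J \<and> \<not> fin G' \<and> n \<in> {1,2} \<and> (\<forall>i. i \<in>\<^sub>m G' \<longrightarrow> has_card n (fib X' i))"
    proof (rule three_element_fibres[OF J(2)])
      show "has_card 3 (fib Y i)" if "i \<in>\<^sub>m J" for i using that by (rule three)
      show "w \<subseteq>\<^sub>m z \<and> has_card 4 w" if "opair z w \<in>\<^sub>m f" for z w using that by (rule f)
      show "w = w'" if "opair z w \<in>\<^sub>m f" "opair z w' \<in>\<^sub>m f" for z w w' using that by (rule fn)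
      show "\<exists>w. opair z w \<in>\<^sub>m f"
        if "z \<subseteq>\<^sub>m Y" "fin z" "\<not> (finite (ext z) \<and> card (ext z) \<le> 4)" for z using that by (rule ex)
    qed
    then obtain X' G' n where "X' \<subseteq>\<^sub>m Y" "G' \<subseteq>\<^sub>m J" "\<not> fin G'" "n \<in> {1,2::nat}" "\<forall>i. i \<in>\<^sub>m G' \<longrightarrow> has_card n (fib X' i)"
      by blast
    moreover from this have "X' \<subseteq>\<^sub>m X" "G' \<subseteq>\<^sub>m G" using YX JG by (simp_all add: subset_def)
    ultimately show ?thesis by blast
  next
    case 3
    \<comment> \<open>Here the choice function applies to each single fibre; \<open>Q\<close> holds
      for the points chosen from their own fibre.\<close>
    define Q where "Q p \<longleftrightarrow> (\<exists>i w. idx p i \<and> opair (fib Y i) w \<in>\<^sub>m f \<and> p \<in>\<^sub>m w)" for p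
    have "definable (\<lambda>e. Q (e 0))" unfolding Q_def by (intro definable_fam)
    note mem = mem_sep[of Q, OF this]
    have "has_card 4 (fib (sep Y Q) i)" if i: "i \<in>\<^sub>m J" for i
    proof -
      have "\<not> (finite (ext (fib Y i)) \<and> card (ext (fib Y i)) \<le> 4)"
        using J(3)[OF i] 3 by (auto simp: P_def has_card_def)
      moreover have "fin (fib Y i)" using fibY JG i by (simp add: subset_def)
      moreover have "fib Y i \<subseteq>\<^sub>m Y" by (simp add: subset_def mem_fib)
      ultimately obtain w where w: "opair (fib Y i) w \<in>\<^sub>m f" using ex by blast
      have "p \<in>\<^sub>m w \<longleftrightarrow> p \<in>\<^sub>m Y \<and> Q p \<and> idx p i" for p
      proof
        assume "p \<in>\<^sub>m w"
        moreover from this have "p \<in>\<^sub>m fib Y i" using f[OF w] by (simp add: subset_def)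
        ultimately show "p \<in>\<^sub>m Y \<and> Q p \<and> idx p i" using w unfolding mem_fib Q_def by blast
      next
        assume "p \<in>\<^sub>m Y \<and> Q p \<and> idx p i"
        then show "p \<in>\<^sub>m w" using w idx_unique fn unfolding Q_def by metis
      qed
      then have "fib (sep Y Q) i = w" unfolding mem_eq_iff mem_fib mem by blast
      then show ?thesis using f[OF w] by simp
    qed
    moreover have "sep Y Q \<subseteq>\<^sub>m X" using YX by (simp add: subset_def mem)
    ultimately show ?thesis using JG J(2) by blast
  qed
qed

text \<open>A second selection is taken from what the first leaves, and the threshold grows by
  \<open>a\<close> so that more than \<open>k\<close> points remain for it. If both have size
  \<open>a\<close>, their union has size \<open>2 * a\<close>; any other size lies in
  \<open>N\<close> and is already a result.\<close>

lemma selectable_double: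
  assumes sel: "selectable k (insert a N)"
  shows "selectable (k + a) (insert (2 * a) N)"
  unfolding selectable_def
proof (intro allI impI, elim conjE)
  fix X G
  assume G: "\<not> fin G"
    and *: "\<forall>i. i \<in>\<^sub>m G \<longrightarrow> fin (fib X i) \<and> \<not> (finite (ext (fib X i)) \<and> card (ext (fib X i)) \<le> k + a)"
  then have "\<forall>i. i \<in>\<^sub>m G \<longrightarrow> fin (fib X i) \<and> \<not> (finite (ext (fib X i)) \<and> card (ext (fib X i)) \<le> k)"
    by auto
  then obtain X1 G1 n where 1: "X1 \<subseteq>\<^sub>m X" "G1 \<subseteq>\<^sub>m G" "\<not> fin G1" "n \<in> insert a N"
      "\<forall>i. i \<in>\<^sub>m G1 \<longrightarrow> has_card n (fib X1 i)"
    using sel G unfolding selectable_def by blast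
  show "\<exists>X' G' n. X' \<subseteq>\<^sub>m X \<and> G' \<subseteq>\<^sub>m G \<and> \<not> fin G' \<and> n \<in> insert (2 * a) N \<and>
      (\<forall>i. i \<in>\<^sub>m G' \<longrightarrow> has_card n (fib X' i))"
  proof (cases "n = a")
    case True
    have "definable (\<lambda>e. \<not> e 0 \<in>\<^sub>m X1)" by (intro definable_fam)
    then obtain Z where Z: "\<And>p. p \<in>\<^sub>m Z \<longleftrightarrow> p \<in>\<^sub>m X \<and> \<not> p \<in>\<^sub>m X1"
      using sep_ex[of "\<lambda>p. \<not> p \<in>\<^sub>m X1" X] by blast
    have "fin (fib Z i) \<and> \<not> (finite (ext (fib Z i)) \<and> card (ext (fib Z i)) \<le> k)" if i: "i \<in>\<^sub>m G1" for i
    proof (intro conjI notI)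
      have iG: "i \<in>\<^sub>m G" using 1(2) i by (simp add: subset_def)
      then show "fin (fib Z i)"
        using * fin_subset[of "fib X i"] by (simp add: subset_def mem_fib Z)
      assume c: "finite (ext (fib Z i)) \<and> card (ext (fib Z i)) \<le> k"
      have "ext (fib X i) = ext (fib X1 i) \<union> ext (fib Z i)"
        using 1(1) by (auto simp: ext_def mem_fib Z subset_def)
      moreover have "has_card a (fib X1 i)" using 1(5) True i by simp
      ultimately have "finite (ext (fib X i))" "card (ext (fib X i)) \<le> k + a"
        using c card_Un_le[of "ext (fib X1 i)" "ext (fib Z i)"] by (auto simp: has_card_def)
      then show False using * iG by blast
    qed
    then obtain X2 G2 m where 2: "X2 \<subseteq>\<^sub>m Z" "G2 \<subseteq>\<^sub>m G1" "\<not> fin G2" "m \<in> insert a N"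
        "\<forall>i. i \<in>\<^sub>m G2 \<longrightarrow> has_card m (fib X2 i)"
      using sel 1(3) unfolding selectable_def by blast
    have sub: "X2 \<subseteq>\<^sub>m X" "G2 \<subseteq>\<^sub>m G" using 1 2 Z by (simp_all add: subset_def)
    show ?thesis
    proof (cases "m = a")
      case m: True
      obtain X3 where X3: "\<And>p. p \<in>\<^sub>m X3 \<longleftrightarrow> p \<in>\<^sub>m X1 \<or> p \<in>\<^sub>m X2"
        using mem_union[of _ "upair X1 X2"] by (metis mem_upair)
      have "has_card (2 * a) (fib X3 i)" if i: "i \<in>\<^sub>m G2" for i
      proof -
        have "ext (fib X3 i) = ext (fib X1 i) \<union> ext (fib X2 i)" by (auto simp: ext_def mem_fib X3)
        moreover have "ext (fib X1 i) \<inter> ext (fib X2 i) = {}"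
          using 2(1) by (auto simp: ext_def mem_fib subset_def Z)
        moreover have "has_card a (fib X1 i)" "has_card a (fib X2 i)" using 1 2 i True m by (auto simp: subset_def)
        ultimately show ?thesis by (simp add: has_card_def card_Un_disjoint)
      qed
      moreover have "X3 \<subseteq>\<^sub>m X" using X3 1(1) sub by (auto simp: subset_def)
      ultimately show ?thesis using sub 2(3) by blast
    next
      case False
      then show ?thesis using 2 sub by blast
    qed
  next
    case False
    then show ?thesis using 1 by blast
  qed
qed

text \<open>The sizes pass from 1, 2, 4 to 2, 4 and then to 4 alone, while the threshold becomes 0 +
  1 + 2 = 3.\<close>

lemma selectable_4:
  assumes "RC_fin (vN 4)"
  shows "selectable 3 {4}"
  using selectable_double[of 1 2 "{4}"] selectable_double[of 0 1 "{2,4}"] selectable_1_2_4[OF assms]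
  by (simp add: numeral_3_eq_3)

section \<open>Choice for a family by means of its disjoint union\<close>

theorem RC_fin_4_imp_C_fin_minus_4:
  assumes RC: "RC_fin (vN 4)"
  shows "C_fin_minus (vN 4)"
  unfolding C_fin_minus_def
proof (intro allI impI, elim conjE)
  fix F
  assume F: "\<not> is_finite F" and gt: "\<forall>A. A \<in>\<^sub>m F \<longrightarrow> finite_card_gt (vN 4) A"
  \<comment> \<open>Members of \<open>F\<close> may overlap. Tagging each point with its set makes
    them disjoint, and the fibre over \<open>A\<close> is a copy of \<open>A\<close>.\<close>
  have "definable (\<lambda>e. e 1 \<in>\<^sub>m e 0)" by (intro definable_fam)
  from rel_ex[of "\<lambda>A a. a \<in>\<^sub>m A", OF this, of F "union F"] obtain X
    where X0: "\<And>q. q \<in>\<^sub>m X \<longleftrightarrow> (\<exists>A a. q = opair A a \<and> A \<in>\<^sub>m F \<and> a \<in>\<^sub>m union F \<and> a \<in>\<^sub>m A)"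
    by blast
  have X: "q \<in>\<^sub>m X \<longleftrightarrow> (\<exists>A a. q = opair A a \<and> A \<in>\<^sub>m F \<and> a \<in>\<^sub>m A)" for q
    unfolding X0 mem_union by blast
  have "fin (fib X A) \<and> \<not> (finite (ext (fib X A)) \<and> card (ext (fib X A)) \<le> 3)" if A: "A \<in>\<^sub>m F" for A
  proof
    have finA: "fin A" and big: "\<not> (finite (ext A) \<and> card (ext A) \<le> 4)"
      using gt A by (simp_all add: finite_card_gt_vN_iff)
    show "fin (fib X A)"
    proof (rule fin_fibres[OF finA, of "\<lambda>p a. p = opair A a"])
      show "definable (\<lambda>e. e 0 = opair A (e 1))" by (intro definable_fam)
      show "\<exists>a. a \<in>\<^sub>m A \<and> p = opair A a" if "p \<in>\<^sub>m fib X A" for p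
        using that by (auto simp: mem_fib X idx_def opair_eq_iff)
      show "fin z" if "\<And>p. p \<in>\<^sub>m z \<Longrightarrow> p \<in>\<^sub>m fib X A \<and> p = opair A a" for a z
        using that by (intro fin_subsingleton) blast
    qed
    have "ext (fib X A) = opair A ` ext A"
      using A by (auto simp: ext_def mem_fib X idx_def opair_eq_iff)
    moreover have "inj_on (opair A) (ext A)" by (simp add: inj_on_def opair_eq_iff)
    ultimately show "\<not> (finite (ext (fib X A)) \<and> card (ext (fib X A)) \<le> 3)"
      using big by (auto simp: card_image dest: finite_imageD)
  qed
  then obtain X' G where X': "X' \<subseteq>\<^sub>m X" and G: "G \<subseteq>\<^sub>m F" "\<not> fin G" "\<And>A. A \<in>\<^sub>m G \<Longrightarrow> has_card 4 (fib X' A)"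
    using selectable_4[OF RC] F unfolding selectable_def is_finite_iff by blast
  \<comment> \<open>Forgetting the tags turns the four selected pairs over \<open>A\<close> into a
    4-element subset of \<open>A\<close>.\<close>
  define R where "R A B \<longleftrightarrow> (\<forall>a. a \<in>\<^sub>m B \<longleftrightarrow> a \<in>\<^sub>m A \<and> opair A a \<in>\<^sub>m X')" for A B
  have R: "definable (\<lambda>e. R (e 0) (e 1))" unfolding R_def by (intro definable_fam)
  \<comment> \<open>The values of the function must come from a set before \<open>rel_ex\<close> can
    collect its pairs.\<close>
  obtain D where D: "\<And>u. u \<in>\<^sub>m D \<longleftrightarrow> u \<subseteq>\<^sub>m union G" using power_set[of "union G"] by blast
  obtain f where f: "\<And>q. q \<in>\<^sub>m f \<longleftrightarrow> (\<exists>A B. q = opair A B \<and> A \<in>\<^sub>m G \<and> B \<in>\<^sub>m D \<and> R A B)"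
    using rel_ex[OF R, of G D] by blast
  have RD: "B \<subseteq>\<^sub>m A \<and> B \<in>\<^sub>m D \<and> B \<in> subsets_card (union G) (vN 4)" if A: "A \<in>\<^sub>m G" and B: "R A B" for A B
  proof -
    have "B \<subseteq>\<^sub>m A" "B \<subseteq>\<^sub>m union G" using A B by (auto simp: R_def subset_def mem_union)
    moreover have "ext (fib X' A) = opair A ` ext B"
      using B X' by (auto simp: ext_def mem_fib R_def subset_def X idx_def opair_eq_iff)
    then have "has_card 4 B"
      using G(3)[OF A] by (auto simp: has_card_def card_image inj_on_def opair_eq_iff dest: finite_imageD)
    ultimately show ?thesis by (simp add: D subsets_card_def equipollent_vN_iff)
  qed
  have R_ex: "\<exists>!B. R A B" for A
  proof -
    have "definable (\<lambda>e. opair A (e 0) \<in>\<^sub>m X')" by (intro definable_fam)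
    from sep_ex[of "\<lambda>a. opair A a \<in>\<^sub>m X'", OF this, of A] show ?thesis
      unfolding R_def by (metis extensionality)
  qed
  have fR: "opair A B \<in>\<^sub>m f \<longleftrightarrow> A \<in>\<^sub>m G \<and> R A B" for A B
    using RD by (auto simp: f opair_eq_iff)
  have fun_f: "is_fun f (ext G) (subsets_card (union G) (vN 4))"
    unfolding is_fun_def
  proof (intro conjI allI impI ballI)
    show "\<exists>A\<in>ext G. \<exists>B\<in>subsets_card (union G) (vN 4). p = opair A B" if "p \<in>\<^sub>m f" for p
      using that RD unfolding f ext_def by blast
    show "\<exists>!B. opair A B \<in>\<^sub>m f" if "A \<in> ext G" for A
      using that R_ex[of A] by (simp add: fR ext_def)
  qed
  moreover have "app f A \<subseteq>\<^sub>m A" if "A \<in> ext G" for A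
    using app_eq[OF fun_f that, of "app f A"] RD by (simp add: fR)
  ultimately show "\<exists>G f. G \<subseteq>\<^sub>m F \<and> \<not> is_finite G \<and>
      is_fun f (ext G) (subsets_card (union G) (vN 4)) \<and> (\<forall>A\<in>ext G. app f A \<subseteq>\<^sub>m A)"
    using G(1,2) unfolding is_finite_iff by blast
qed

end

theorem theorem6p2:
  fixes mem :: "'a \<Rightarrow> 'a \<Rightarrow> bool"
  assumes "ZF mem"
    and "set_structure.RC_fin mem (set_structure.vN mem 4)"
  shows "set_structure.C_fin_minus mem (set_structure.vN mem 4)"
  using ZF.RC_fin_4_imp_C_fin_minus_4[OF assms] .

end
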